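(* Let $(G,o)$ be a unimodular random graph and consider a BRW on $G$ that is transient ($\mu$-a.s.). Then almost surely the trace $\mathtt{Tr}$ of the BRW is transient for the simple random walk on $\mathtt{Tr}$.
   Context: Graphs are infinite, connected, locally finite with uniformly bounded degrees. SRW on $G$: $p(x,y)=1/\deg(x)$ for $x\sim y$. BRW with offspring distribution $(p_k)$, $p_0=0$, $p_1<1$, mean $m$: the tree-indexed walk $(S_v)_{v\in\mathbb{T}}$ with $\mathbb{T}$ a Galton–Watson tree with law $(p_k)$, $S_{\mathbf r}=o$, and each $S_v$ chosen from $p(S_{v^-},\cdot)$ independently ($v^-$ the parent of $v$). The BRW is transient if for each $x$, a.s. only finitely many $v$ have $S_v=x$. The trace $\mathtt{Tr}$ is the random subgraph of $G$ with vertex set $\{S_v: v\in\mathbb{T}\}$ and edge set $\{\{S_{v^-},S_v\}: v\in\mathbb{T}\setminus\{\mathbf r\}\}$. A URG is a random rooted graph $(G,o)$ whose law $\mu$ on the space $\mathcal{G}_*$ of isomorphism classes of rooted graphs satisfies the mass-transport principle: $\int\sum_{x}f(G,o,x)\,d\mu=\int\sum_x f(G,x,o)\,d\mu$ for all Borel $f\ge0$ on doubly rooted graphs. The family tree and the walk steps are independent of $(G,o)$ given $G$. *)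

theory Defs
  imports "HOL-Probability.Probability"
begin

text \<open>Graphs are labelled by nat (vertex set = all of nat, so infinite);
  a graph is an adjacency relation.\<close>
type_synonym graph = "nat \<Rightarrow> nat \<Rightarrow> bool"

definition graph_space :: "graph measure" where
  "graph_space = PiM UNIV (\<lambda>_. PiM UNIV (\<lambda>_. count_space UNIV))"

definition nbrs :: "graph \<Rightarrow> nat \<Rightarrow> nat set" where
  "nbrs E x = {y. E x y}"

definition deg :: "graph \<Rightarrow> nat \<Rightarrow> nat" where
  "deg E x = card (nbrs E x)"

text \<open>Simple, connected, locally finite graph on vertex set nat with degrees bounded by D.\<close>
definition good_graph :: "graph \<Rightarrow> nat \<Rightarrow> bool" where
  "good_graph E D \<longleftrightarrow>
     (\<forall>x y. E x y \<longrightarrow> E y x) \<and> (\<forall>x. \<not> E x x) \<and>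
     (\<forall>x y. (x, y) \<in> {(a, b). E a b}\<^sup>*) \<and>
     (\<forall>x. finite (nbrs E x) \<and> deg E x \<le> D)"

text \<open>Unimodularity: a probability law on labelled rooted graphs satisfying the
  mass-transport principle for all measurable isomorphism-invariant f.\<close>
definition unimodular :: "(graph \<times> nat) measure \<Rightarrow> bool" where
  "unimodular \<mu> \<longleftrightarrow> prob_space \<mu> \<and>
     sets \<mu> = sets (graph_space \<Otimes>\<^sub>M count_space UNIV) \<and>
     (\<forall>f \<in> borel_measurable (graph_space \<Otimes>\<^sub>M (count_space UNIV \<Otimes>\<^sub>M count_space UNIV)).
        (\<forall>E x y \<pi>. bij \<pi> \<longrightarrow> f ((\<lambda>a b. E (\<pi> a) (\<pi> b)), x, y) = f (E, \<pi> x, \<pi> y)) \<longrightarrow>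
        (\<integral>\<^sup>+ Go. (\<Sum>z. f (fst Go, snd Go, z)) \<partial>\<mu>) =
        (\<integral>\<^sup>+ Go. (\<Sum>z. f (fst Go, z, snd Go)) \<partial>\<mu>))"

text \<open>Ulam--Harris tree; a node is a reversed list of child indices (parent of i#v is v).
  N v is the number of children of v.\<close>
fun in_tree :: "(nat list \<Rightarrow> nat) \<Rightarrow> nat list \<Rightarrow> bool" where
  "in_tree N [] = True"
| "in_tree N (i # v) = (in_tree N v \<and> i < N v)"

text \<open>Position of node v: J (v, x) is the independent uniform neighbour of x used
  when v's parent sits at x.\<close>
fun brw_pos :: "nat \<Rightarrow> (nat list \<times> nat \<Rightarrow> nat) \<Rightarrow> nat list \<Rightarrow> nat" where
  "brw_pos r J [] = r"
| "brw_pos r J (i # v) = J (i # v, brw_pos r J v)"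

definition brw_space :: "nat pmf \<Rightarrow> graph \<Rightarrow> ((nat list \<Rightarrow> nat) \<times> (nat list \<times> nat \<Rightarrow> nat)) measure" where
  "brw_space p E =
     PiM UNIV (\<lambda>_::nat list. measure_pmf p) \<Otimes>\<^sub>M
     PiM UNIV (\<lambda>vx::nat list \<times> nat. measure_pmf (pmf_of_set (nbrs E (snd vx))))"

definition brw_transient :: "nat pmf \<Rightarrow> graph \<Rightarrow> nat \<Rightarrow> bool" where
  "brw_transient p E r \<longleftrightarrow>
     (\<forall>x. AE \<omega> in brw_space p E. finite {v. in_tree (fst \<omega>) v \<and> brw_pos r (snd \<omega>) v = x})"

definition trace :: "(nat list \<Rightarrow> nat) \<Rightarrow> (nat list \<times> nat \<Rightarrow> nat) \<Rightarrow> nat \<Rightarrow> graph" where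
  "trace N J r a b \<longleftrightarrow>
     (\<exists>i v. in_tree N (i # v) \<and> {brw_pos r J v, brw_pos r J (i # v)} = {a, b})"

text \<open>first_ret A r n x = probability that SRW on A started at x first hits r
  at a time \<ge> 1 exactly at time n.\<close>
fun first_ret :: "graph \<Rightarrow> nat \<Rightarrow> nat \<Rightarrow> nat \<Rightarrow> real" where
  "first_ret A r 0 x = 0"
| "first_ret A r (Suc n) x =
     (\<Sum>y\<in>nbrs A x. (1 / real (deg A x)) *
        (if y = r then (if n = 0 then 1 else 0) else first_ret A r n y))"

text \<open>Transience of SRW: return probability to the start vertex is < 1.\<close>
definition srw_transient :: "graph \<Rightarrow> nat \<Rightarrow> bool" where
  "srw_transient A r \<longleftrightarrow> (\<Sum>n. ennreal (first_ret A r n r)) < 1"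

end

theory Submission
  imports Defs
begin

text \<open>
  Transience of the branching random walk with mean offspring above one forces the spectral radius
  of the underlying graph below one: if the heat kernel satisfied \<open>p\<^sub>N(x,x) > \<lambda>\<^sup>N\<close> for some \<open>N\<close>
  and \<open>\<lambda> = 1/(1 + q/2)\<close>, where \<open>q = P(at least two children)\<close>, then the function
  \<open>\<Sum>k<N. \<lambda>\<^sup>-\<^sup>k p\<^sub>k(\<cdot>,x)\<close> would give a lower bound, uniform in \<open>n\<close>, for the probability of visiting
  the root after generation \<open>n\<close>. So \<open>p\<^sub>N(x,x) \<le> \<lambda>\<^sup>N\<close> for all \<open>x\<close> and \<open>N\<close>, and by reversibility two
  independent random walks meet a bounded expected number of times, uniformly in the starting point.
  Now send a unit flow from the root through the family tree, splitting it evenly between the first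
  two children of every branching node. A one-step decomposition bounds the expected sum of the
  squared vertex occupations of its image in the trace. This sum dominates the energy of the image
  flow in the simple graph, so the trace carries a unit flow of finite energy, and testing that
  flow against the hitting probabilities of the root gives transience.
\<close>

subsection \<open>Splitting infinite product measures\<close>

text \<open>Product measures are determined by cylinder rectangles, and the mass of such a rectangle
  factorises over its left and its right coordinates.\<close>

lemma PiM_case_sum:
  fixes K1 :: "'a \<Rightarrow> 'c measure" and K2 :: "'b \<Rightarrow> 'c measure"
  assumes K1: "\<And>i. prob_space (K1 i)" and K2: "\<And>i. prob_space (K2 i)"
  shows "distr (PiM UNIV K1 \<Otimes>\<^sub>M PiM UNIV K2) (PiM UNIV (case_sum K1 K2)) (\<lambda>(a, b). case_sum a b)
       = PiM UNIV (case_sum K1 K2)"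
proof (rule measure_eqI_PiM_infinite)
  let ?K = "case_sum K1 K2"
  have K: "prob_space (?K i)" for i using K1 K2 by (cases i) auto
  interpret P1: prob_space "PiM UNIV K1" by (rule prob_space_PiM[OF K1])
  interpret P2: prob_space "PiM UNIV K2" by (rule prob_space_PiM[OF K2])
  interpret PP: pair_prob_space "PiM UNIV K1" "PiM UNIV K2" ..
  have meas: "(\<lambda>(a, b). case_sum a b) \<in> PiM UNIV K1 \<Otimes>\<^sub>M PiM UNIV K2 \<rightarrow>\<^sub>M PiM UNIV ?K"
  proof (rule measurable_PiM_single')
    fix i :: "'a + 'b"
    show "(\<lambda>\<omega>. (case \<omega> of (a, b) \<Rightarrow> case_sum a b) i) \<in> PiM UNIV K1 \<Otimes>\<^sub>M PiM UNIV K2 \<rightarrow>\<^sub>M ?K i"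
      by (cases i) (simp_all add: split_beta)
  qed (auto simp: space_pair_measure space_PiM PiE_iff split: sum.split)
  show "finite_measure (distr (PiM UNIV K1 \<Otimes>\<^sub>M PiM UNIV K2) (PiM UNIV ?K) (\<lambda>(a, b). case_sum a b))"
    by (rule PP.finite_measure_distr[OF meas])
  fix A :: "'a + 'b \<Rightarrow> 'c set" and J :: "('a + 'b) set"
  assume J: "finite J" and A: "\<And>i. i \<in> J \<Longrightarrow> A i \<in> sets (?K i)"
  define J1 J2 where "J1 = Inl -` J" and "J2 = Inr -` J"
  have fin: "finite J1" "finite J2"
    using J by (auto simp: J1_def J2_def intro!: finite_vimageI)
  have Jeq: "J = Inl ` J1 \<union> Inr ` J2"
    by (auto simp: J1_def J2_def image_iff) (metis sum.exhaust)
  have A1: "A (Inl i) \<in> sets (K1 i)" if "i \<in> J1" for i using A[of "Inl i"] that by (simp add: J1_def)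
  have A2: "A (Inr i) \<in> sets (K2 i)" if "i \<in> J2" for i using A[of "Inr i"] that by (simp add: J2_def)
  let ?E = "prod_emb UNIV ?K J (Pi\<^sub>E J A)"
  let ?E1 = "prod_emb UNIV K1 J1 (Pi\<^sub>E J1 (\<lambda>i. A (Inl i)))"
  let ?E2 = "prod_emb UNIV K2 J2 (Pi\<^sub>E J2 (\<lambda>i. A (Inr i)))"
  have emb: "\<omega> \<in> prod_emb UNIV K J (Pi\<^sub>E J A) \<longleftrightarrow> \<omega> \<in> space (PiM UNIV K) \<and> (\<forall>i\<in>J. \<omega> i \<in> A i)"
    for K :: "'z \<Rightarrow> 'c measure" and J A \<omega>
    by (auto simp: prod_emb_def space_PiM PiE_iff)
  have vim: "(\<lambda>(a, b). case_sum a b) -` ?E \<inter> space (PiM UNIV K1 \<Otimes>\<^sub>M PiM UNIV K2) = ?E1 \<times> ?E2"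
  proof -
    have "case_sum a b \<in> space (PiM UNIV ?K) \<and> (\<forall>i\<in>J. case_sum a b i \<in> A i) \<longleftrightarrow>
       (a \<in> space (PiM UNIV K1) \<and> (\<forall>i\<in>J1. a i \<in> A (Inl i))) \<and>
       (b \<in> space (PiM UNIV K2) \<and> (\<forall>i\<in>J2. b i \<in> A (Inr i)))" for a b
      unfolding Jeq by (auto simp: space_PiM PiE_iff split_sum_all ball_Un)
    then show ?thesis
      by (intro set_eqI) (simp only: emb vimage_def Int_iff mem_Collect_eq mem_Times_iff space_pair_measure split_beta conj_ac, blast)
  qed
  have "emeasure (distr (PiM UNIV K1 \<Otimes>\<^sub>M PiM UNIV K2) (PiM UNIV ?K) (\<lambda>(a, b). case_sum a b)) ?E
      = emeasure (PiM UNIV K1 \<Otimes>\<^sub>M PiM UNIV K2) (?E1 \<times> ?E2)"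
    by (subst emeasure_distr[OF meas]) (auto simp: vim J A intro!: sets_PiM_I)
  also have "\<dots> = emeasure (PiM UNIV K1) ?E1 * emeasure (PiM UNIV K2) ?E2"
    by (rule P2.emeasure_pair_measure_Times) (auto intro!: sets_PiM_I fin A1 A2)
  also have "\<dots> = (\<Prod>i\<in>J1. emeasure (K1 i) (A (Inl i))) * (\<Prod>i\<in>J2. emeasure (K2 i) (A (Inr i)))"
    by (simp add: emeasure_PiM_emb K1 K2 fin A1 A2)
  also have "\<dots> = (\<Prod>i\<in>J. emeasure (?K i) (A i))"
    unfolding Jeq by (subst prod.union_disjoint) (auto simp: fin prod.reindex inj_on_def)
  also have "\<dots> = emeasure (PiM UNIV ?K) ?E"
    using J A by (simp add: emeasure_PiM_emb K)
  finally show "emeasure (distr (PiM UNIV K1 \<Otimes>\<^sub>M PiM UNIV K2) (PiM UNIV ?K) (\<lambda>(a, b). case_sum a b)) ?E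
      = emeasure (PiM UNIV ?K) ?E" .
qed simp_all

text \<open>Splitting undoes merging, so pushing \<open>PiM_case_sum\<close> forward along the
  splitting map gives back the pair measure.\<close>

lemma distr_PiM_case_sum:
  fixes K1 :: "'a \<Rightarrow> 'c measure" and K2 :: "'b \<Rightarrow> 'c measure"
  assumes K1: "\<And>i. prob_space (K1 i)" and K2: "\<And>i. prob_space (K2 i)"
  shows "distr (PiM UNIV (case_sum K1 K2)) (PiM UNIV K1 \<Otimes>\<^sub>M PiM UNIV K2)
           (\<lambda>\<omega>. (\<lambda>i. \<omega> (Inl i), \<lambda>i. \<omega> (Inr i))) = PiM UNIV K1 \<Otimes>\<^sub>M PiM UNIV K2"
proof -
  have m1: "(\<lambda>(a, b). case_sum a b) \<in> PiM UNIV K1 \<Otimes>\<^sub>M PiM UNIV K2 \<rightarrow>\<^sub>M PiM UNIV (case_sum K1 K2)"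
  proof (rule measurable_PiM_single')
    fix i :: "'a + 'b"
    show "(\<lambda>\<omega>. (case \<omega> of (a, b) \<Rightarrow> case_sum a b) i) \<in> PiM UNIV K1 \<Otimes>\<^sub>M PiM UNIV K2 \<rightarrow>\<^sub>M case_sum K1 K2 i"
      by (cases i) (simp_all add: split_beta)
  qed (auto simp: space_pair_measure space_PiM PiE_iff split: sum.split)
  have c: "(\<lambda>\<omega>. \<omega> (Inl i)) \<in> PiM UNIV (case_sum K1 K2) \<rightarrow>\<^sub>M K1 i"
      "(\<lambda>\<omega>. \<omega> (Inr j)) \<in> PiM UNIV (case_sum K1 K2) \<rightarrow>\<^sub>M K2 j" for i j
    using measurable_component_singleton[of "Inl i" UNIV "case_sum K1 K2"]
      measurable_component_singleton[of "Inr j" UNIV "case_sum K1 K2"] by simp_all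
  have m2: "(\<lambda>\<omega>. (\<lambda>i. \<omega> (Inl i), \<lambda>i. \<omega> (Inr i))) \<in>
      PiM UNIV (case_sum K1 K2) \<rightarrow>\<^sub>M PiM UNIV K1 \<Otimes>\<^sub>M PiM UNIV K2"
    by (intro measurable_Pair measurable_PiM_single' c)
       (auto simp: space_PiM PiE_iff split_sum_all)
  show ?thesis
    by (subst PiM_case_sum[OF K1 K2, symmetric])
       (simp add: distr_distr[OF m2 m1] comp_def split_beta distr_id2)
qed

text \<open>Independence of two disjoint families of coordinates, in Fubini form. Coordinates
  outside both ranges are integrated out.\<close>

lemma nn_integral_PiM_blocks:
  fixes K :: "'i \<Rightarrow> 'c measure"
  assumes K: "\<And>i. prob_space (K i)"
    and f: "inj f" and g: "inj g" and fg: "range f \<inter> range g = {}"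
    and F: "F \<in> borel_measurable (PiM UNIV (\<lambda>j. K (f j)) \<Otimes>\<^sub>M PiM UNIV (\<lambda>j. K (g j)))"
  shows "(\<integral>\<^sup>+\<omega>. F (\<lambda>j. \<omega> (f j), \<lambda>j. \<omega> (g j)) \<partial>PiM UNIV K) =
    (\<integral>\<^sup>+a. \<integral>\<^sup>+b. F (a, b) \<partial>PiM UNIV (\<lambda>j. K (g j)) \<partial>PiM UNIV (\<lambda>j. K (f j)))"
proof -
  let ?h = "case_sum f g"
  let ?K1 = "\<lambda>j. K (f j)" and ?K2 = "\<lambda>j. K (g j)"
  have ne: "f j \<noteq> g k" "g k \<noteq> f j" for j k using fg by auto
  have inj: "inj ?h" using f g ne by (auto simp: inj_def split: sum.split)
  have Kh: "(\<lambda>i. K (?h i)) = case_sum ?K1 ?K2" by (auto split: sum.split)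
  interpret P2: prob_space "PiM UNIV ?K2" by (rule prob_space_PiM) (rule K)
  \<comment> \<open>Only injectivity of \<open>case_sum f g\<close> matters here: the marginal of a
    product on any set of coordinates is again a product.\<close>
  have re: "distr (PiM UNIV K) (PiM UNIV (case_sum ?K1 ?K2)) (\<lambda>\<omega> n. \<omega> (?h n)) = PiM UNIV (case_sum ?K1 ?K2)"
    using distr_PiM_reindex[of UNIV K ?h UNIV] K inj by (simp add: Kh restrict_def)
  have mh: "(\<lambda>\<omega> n. \<omega> (?h n)) \<in> PiM UNIV K \<rightarrow>\<^sub>M PiM UNIV (case_sum ?K1 ?K2)"
    unfolding Kh[symmetric] by (rule measurable_PiM_single') (auto simp: space_PiM PiE_iff)
  have c: "(\<lambda>\<omega>. \<omega> (Inl i)) \<in> PiM UNIV (case_sum ?K1 ?K2) \<rightarrow>\<^sub>M ?K1 i"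
      "(\<lambda>\<omega>. \<omega> (Inr j)) \<in> PiM UNIV (case_sum ?K1 ?K2) \<rightarrow>\<^sub>M ?K2 j" for i j
    using measurable_component_singleton[of "Inl i" UNIV "case_sum ?K1 ?K2"]
      measurable_component_singleton[of "Inr j" UNIV "case_sum ?K1 ?K2"] by simp_all
  have m2: "(\<lambda>\<omega>. (\<lambda>i. \<omega> (Inl i), \<lambda>i. \<omega> (Inr i))) \<in>
      PiM UNIV (case_sum ?K1 ?K2) \<rightarrow>\<^sub>M PiM UNIV ?K1 \<Otimes>\<^sub>M PiM UNIV ?K2"
    by (intro measurable_Pair measurable_PiM_single' c)
       (auto simp: space_PiM PiE_iff split_sum_all)
  note F' = measurable_compose[OF m2 F]
  have "(\<integral>\<^sup>+\<omega>. F (\<lambda>j. \<omega> (f j), \<lambda>j. \<omega> (g j)) \<partial>PiM UNIV K) =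
      (\<integral>\<^sup>+\<omega>. F (\<lambda>j. \<omega> (Inl j), \<lambda>j. \<omega> (Inr j)) \<partial>distr (PiM UNIV K) (PiM UNIV (case_sum ?K1 ?K2)) (\<lambda>\<omega> n. \<omega> (?h n)))"
    by (subst nn_integral_distr[OF mh]) (use F' in simp_all)
  also have "\<dots> = (\<integral>\<^sup>+\<omega>. F \<omega> \<partial>distr (PiM UNIV (case_sum ?K1 ?K2)) (PiM UNIV ?K1 \<Otimes>\<^sub>M PiM UNIV ?K2)
           (\<lambda>\<omega>. (\<lambda>i. \<omega> (Inl i), \<lambda>i. \<omega> (Inr i))))"
    unfolding re by (subst nn_integral_distr[OF m2]) (use F in simp_all)
  also have "\<dots> = (\<integral>\<^sup>+\<omega>. F \<omega> \<partial>(PiM UNIV ?K1 \<Otimes>\<^sub>M PiM UNIV ?K2))"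
    by (subst distr_PiM_case_sum) (simp_all add: K)
  also have "\<dots> = (\<integral>\<^sup>+a. \<integral>\<^sup>+b. F (a, b) \<partial>PiM UNIV ?K2 \<partial>PiM UNIV ?K1)"
    by (rule P2.nn_integral_fst[symmetric, OF F])
  finally show ?thesis .
qed

text \<open>A single coordinate is a block indexed by \<open>unit\<close>.\<close>

lemma nn_integral_PiM_coord_block:
  fixes K :: "'i \<Rightarrow> 'c measure"
  assumes K: "\<And>i. prob_space (K i)"
    and f: "inj f" and c: "c \<notin> range f"
    and F: "(\<lambda>(z, \<omega>). F z \<omega>) \<in> borel_measurable (K c \<Otimes>\<^sub>M PiM UNIV (\<lambda>j. K (f j)))"
  shows "(\<integral>\<^sup>+\<omega>. F (\<omega> c) (\<lambda>j. \<omega> (f j)) \<partial>PiM UNIV K) =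
    (\<integral>\<^sup>+z. \<integral>\<^sup>+\<omega>. F z \<omega> \<partial>PiM UNIV (\<lambda>j. K (f j)) \<partial>K c)"
proof -
  interpret P2: prob_space "PiM UNIV (\<lambda>j. K (f j))" by (rule prob_space_PiM) (rule K)
  have m: "(\<lambda>x. F (fst x ()) (snd x)) \<in> borel_measurable (PiM UNIV (\<lambda>_::unit. K c) \<Otimes>\<^sub>M PiM UNIV (\<lambda>j. K (f j)))"
  proof -
    have "(\<lambda>x. (fst x (), snd x)) \<in> PiM UNIV (\<lambda>_::unit. K c) \<Otimes>\<^sub>M PiM UNIV (\<lambda>j. K (f j)) \<rightarrow>\<^sub>M K c \<Otimes>\<^sub>M PiM UNIV (\<lambda>j. K (f j))"
      by measurable
    from measurable_compose[OF this F] show ?thesis by simp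
  qed
  have "(\<integral>\<^sup>+\<omega>. F (\<omega> c) (\<lambda>j. \<omega> (f j)) \<partial>PiM UNIV K) = (\<integral>\<^sup>+a. \<integral>\<^sup>+b. F (a ()) b \<partial>PiM UNIV (\<lambda>j. K (f j)) \<partial>PiM UNIV (\<lambda>_::unit. K c))"
    using nn_integral_PiM_blocks[OF K, where f="\<lambda>_::unit. c" and g=f and F="\<lambda>x. F (fst x ()) (snd x)"] m f c
    by (auto simp: inj_def)
  also have "\<dots> = (\<integral>\<^sup>+z. \<integral>\<^sup>+b. F z b \<partial>PiM UNIV (\<lambda>j. K (f j)) \<partial>distr (PiM UNIV (\<lambda>_::unit. K c)) (K c) (\<lambda>\<omega>. \<omega> ()))"
    using P2.borel_measurable_nn_integral[OF F]
    by (subst nn_integral_distr) auto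
  also have "distr (PiM UNIV (\<lambda>_::unit. K c)) (K c) (\<lambda>\<omega>. \<omega> ()) = K c"
    using distr_PiM_component[of UNIV "\<lambda>_::unit. K c"] K by auto
  finally show ?thesis .
qed

text \<open>The form needed at a branching node: \<open>c\<close> carries the number of children,
  \<open>f\<close> and \<open>g\<close> the data of two children. First \<open>c\<close> is
  separated from both blocks, then the blocks from each other.\<close>

lemma nn_integral_PiM_coord_two_blocks:
  fixes K :: "'i \<Rightarrow> 'c measure"
  assumes K: "\<And>i. prob_space (K i)"
    and f: "inj f" and g: "inj g" and fg: "range f \<inter> range g = {}"
    and c: "c \<notin> range f" "c \<notin> range g"
    and a: "a \<in> borel_measurable (K c)"
    and G: "G \<in> borel_measurable (PiM UNIV (\<lambda>j. K (f j)))"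
    and H: "H \<in> borel_measurable (PiM UNIV (\<lambda>j. K (g j)))"
  shows "(\<integral>\<^sup>+\<omega>. a (\<omega> c) * (G (\<lambda>j. \<omega> (f j)) * H (\<lambda>j. \<omega> (g j))) \<partial>PiM UNIV K) =
    (\<integral>\<^sup>+z. a z \<partial>K c) * ((\<integral>\<^sup>+\<omega>. G \<omega> \<partial>PiM UNIV (\<lambda>j. K (f j))) * (\<integral>\<^sup>+\<omega>. H \<omega> \<partial>PiM UNIV (\<lambda>j. K (g j))))"
proof -
  let ?h = "case_sum f g"
  let ?K1 = "\<lambda>j. K (f j)" and ?K2 = "\<lambda>j. K (g j)"
  let ?Kh = "\<lambda>j. K (?h j)"
  interpret P2: prob_space "PiM UNIV ?K2" by (rule prob_space_PiM) (rule K)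
  interpret P1: prob_space "PiM UNIV ?K1" by (rule prob_space_PiM) (rule K)
  have ne: "f j \<noteq> g k" "g k \<noteq> f j" for j k using fg by auto
  have inj: "inj ?h" using f g ne by (auto simp: inj_def split: sum.split)
  have cm: "(\<lambda>\<omega>. \<omega> (Inl i)) \<in> PiM UNIV ?Kh \<rightarrow>\<^sub>M ?K1 i"
      "(\<lambda>\<omega>. \<omega> (Inr j)) \<in> PiM UNIV ?Kh \<rightarrow>\<^sub>M ?K2 j" for i j
    using measurable_component_singleton[of "Inl i" UNIV "?Kh"]
      measurable_component_singleton[of "Inr j" UNIV "?Kh"] by simp_all
  have "(\<lambda>\<omega> i. \<omega> (Inl i)) \<in> PiM UNIV ?Kh \<rightarrow>\<^sub>M PiM UNIV ?K1"
       "(\<lambda>\<omega> i. \<omega> (Inr i)) \<in> PiM UNIV ?Kh \<rightarrow>\<^sub>M PiM UNIV ?K2"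
    by (intro measurable_PiM_single' cm; auto simp: space_PiM PiE_iff split_sum_all)+
  note [measurable] = measurable_compose[OF this(1) G] measurable_compose[OF this(2) H]
  note [measurable] = a
  have "(\<integral>\<^sup>+\<omega>. a (\<omega> c) * (G (\<lambda>j. \<omega> (f j)) * H (\<lambda>j. \<omega> (g j))) \<partial>PiM UNIV K) =
    (\<integral>\<^sup>+z. \<integral>\<^sup>+\<omega>. a z * (G (\<lambda>j. \<omega> (Inl j)) * H (\<lambda>j. \<omega> (Inr j))) \<partial>PiM UNIV ?Kh \<partial>K c)"
    using nn_integral_PiM_coord_block[where K=K and f="?h" and c=c and F="\<lambda>z \<omega>. a z * (G (\<lambda>j. \<omega> (Inl j)) * H (\<lambda>j. \<omega> (Inr j)))"] c K inj
    by (force split: sum.splits)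
  also have "\<dots> = (\<integral>\<^sup>+z. a z \<partial>K c) * (\<integral>\<^sup>+\<omega>. (G (\<lambda>j. \<omega> (Inl j)) * H (\<lambda>j. \<omega> (Inr j))) \<partial>PiM UNIV ?Kh)"
    by (simp add: nn_integral_cmult nn_integral_multc)
  also have "(\<integral>\<^sup>+\<omega>. (G (\<lambda>j. \<omega> (Inl j)) * H (\<lambda>j. \<omega> (Inr j))) \<partial>PiM UNIV ?Kh) =
      (\<integral>\<^sup>+a. \<integral>\<^sup>+b. G a * H b \<partial>PiM UNIV ?K2 \<partial>PiM UNIV ?K1)"
    using nn_integral_PiM_blocks[of ?Kh Inl Inr "\<lambda>x. G (fst x) * H (snd x)"] K G H by auto
  also have "\<dots> = (\<integral>\<^sup>+\<omega>. G \<omega> \<partial>PiM UNIV ?K1) * (\<integral>\<^sup>+\<omega>. H \<omega> \<partial>PiM UNIV ?K2)"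
    using G H by (simp add: nn_integral_cmult nn_integral_multc)
  finally show ?thesis .
qed

subsection \<open>First-step decomposition of the branching random walk\<close>

type_synonym brw = "(nat list \<Rightarrow> nat) \<times> (nat list \<times> nat \<Rightarrow> nat)"

definition nbr_pmf :: "graph \<Rightarrow> nat \<Rightarrow> nat pmf" where
  "nbr_pmf E x = pmf_of_set (nbrs E x)"

text \<open>Offspring numbers and steps become one family over a sum type, so that the independence
  lemmas for a single product apply to both at once.\<close>

definition brw_law :: "nat pmf \<Rightarrow> graph \<Rightarrow> nat list + nat list \<times> nat \<Rightarrow> nat measure" where
  "brw_law p E = case_sum (\<lambda>_. measure_pmf p) (\<lambda>q. measure_pmf (nbr_pmf E (snd q)))"

text \<open>
  The entries \<open>J ([], y)\<close> never influence a walk. In the subtree of child \<open>i\<close> they must not be the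
  entries \<open>J ([i], y)\<close>, one of which moves the child itself; taking \<open>J ([i + 2], y)\<close> instead keeps
  the subtrees of the children 0 and 1 independent of these moves and of each other, with law
  \<^const>\<open>brw_space\<close>.
\<close>

definition subtree :: "nat \<Rightarrow> brw \<Rightarrow> brw" where
  "subtree i \<omega> = (\<lambda>v. fst \<omega> (v @ [i]), \<lambda>q. snd \<omega> (if fst q = [] then [i + 2] else fst q @ [i], snd q))"

text \<open>\<open>None\<close> is the entry that moves child \<open>i\<close> away from
  \<open>x\<close>; \<open>Some c\<close> is the entry of the whole environment that
  \<open>subtree i\<close> reads as its entry \<open>c\<close>.\<close>

definition child_coord :: "nat \<Rightarrow> nat \<Rightarrow> (nat list + nat list \<times> nat) option \<Rightarrow> nat list + nat list \<times> nat" where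
  "child_coord i x c = (case c of None \<Rightarrow> Inr ([i], x)
     | Some (Inl v) \<Rightarrow> Inl (v @ [i])
     | Some (Inr q) \<Rightarrow> Inr (if fst q = [] then [i + 2] else fst q @ [i], snd q))"

lemma prob_space_brw_law: "prob_space (brw_law p E c)"
  by (cases c) (auto simp: brw_law_def measure_pmf.prob_space_axioms)

lemma sets_brw_law: "sets (brw_law p E c) = UNIV"
  by (cases c) (auto simp: brw_law_def)

lemma prob_space_brw_space: "prob_space (brw_space p E)"
proof -
  interpret P1: prob_space "PiM UNIV (\<lambda>_::nat list. measure_pmf p)"
    by (rule prob_space_PiM) (rule measure_pmf.prob_space_axioms)
  interpret P2: prob_space "PiM UNIV (\<lambda>vx::nat list \<times> nat. measure_pmf (pmf_of_set (nbrs E (snd vx))))"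
    by (rule prob_space_PiM) (rule measure_pmf.prob_space_axioms)
  interpret pair_prob_space "PiM UNIV (\<lambda>_::nat list. measure_pmf p)" "PiM UNIV (\<lambda>vx::nat list \<times> nat. measure_pmf (pmf_of_set (nbrs E (snd vx))))" ..
  show ?thesis unfolding brw_space_def by (rule prob_space_axioms)
qed

lemma space_brw_space: "space (brw_space p E) = UNIV"
  by (simp add: brw_space_def space_pair_measure space_PiM)

text \<open>Among the step entries, \<open>[i]\<close>, \<open>[i + 2]\<close> and the lists of
  length at least two never coincide, and the position is kept.\<close>

lemma inj_child_coord: "inj (child_coord i x)"
proof (rule injI)
  fix c d assume eq: "child_coord i x c = child_coord i x d"
  show "c = d"
  proof (cases c)
    case None then show ?thesis using eq by (cases d) (auto simp: child_coord_def split: sum.splits if_splits)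
  next
    case (Some c')
    then show ?thesis using eq
      by (cases c'; cases d) (auto simp: child_coord_def prod_eq_iff split: sum.splits if_splits)
  qed
qed

text \<open>Last letters are 0 or 2 on one side and 1 or 3 on the other.\<close>

lemma child_coord_disjoint: "range (child_coord 0 x) \<inter> range (child_coord 1 y) = {}"
proof -
  have "child_coord 0 x c \<noteq> child_coord 1 y d" for c d
    by (cases c; cases d) (auto simp: child_coord_def split: sum.splits if_splits)
  then show ?thesis by fastforce
qed

lemma root_notin_child_coord: "Inl [] \<notin> range (child_coord i x)"
  by (auto simp: child_coord_def split: sum.splits option.splits)

text \<open>The law of an entry depends only on its kind and its position, and passing to a subtree
  preserves both. This is the self-similarity of the walk.\<close>

lemma brw_law_child_coord:
  "brw_law p E (child_coord i x None) = nbr_pmf E x"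
  "brw_law p E (child_coord i x (Some c)) = brw_law p E c"
  by (auto simp: brw_law_def child_coord_def split: sum.splits)

lemma distr_brw_law:
  "distr (PiM UNIV (brw_law p E)) (brw_space p E) (\<lambda>\<omega>. (\<lambda>v. \<omega> (Inl v), \<lambda>q. \<omega> (Inr q))) = brw_space p E"
  unfolding brw_law_def brw_space_def nbr_pmf_def
  by (rule distr_PiM_case_sum) (rule measure_pmf.prob_space_axioms)+

lemma measurable_discrete_coord:
  assumes "sets (K c) = UNIV"
  shows "(\<lambda>\<omega>. \<omega> c) \<in> PiM UNIV K \<rightarrow>\<^sub>M count_space UNIV"
proof -
  have "PiM UNIV K \<rightarrow>\<^sub>M K c = PiM UNIV K \<rightarrow>\<^sub>M count_space UNIV"
    by (rule measurable_cong_sets) (simp_all add: assms)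
  then show ?thesis using measurable_component_singleton[of c UNIV K] by simp
qed

lemma measurable_brw_components [measurable]:
  "(\<lambda>\<omega>. fst \<omega> v) \<in> brw_space p E \<rightarrow>\<^sub>M count_space UNIV"
  "(\<lambda>\<omega>. snd \<omega> q) \<in> brw_space p E \<rightarrow>\<^sub>M count_space UNIV"
proof -
  have 1: "(\<lambda>\<omega>::nat list \<Rightarrow> nat. \<omega> v) \<in> PiM UNIV (\<lambda>_. measure_pmf p) \<rightarrow>\<^sub>M count_space UNIV"
    using measurable_component_singleton[of v UNIV "\<lambda>_. measure_pmf p"] by simp
  have 2: "(\<lambda>\<omega>::nat list \<times> nat \<Rightarrow> nat. \<omega> q) \<in> PiM UNIV (\<lambda>vx. measure_pmf (pmf_of_set (nbrs E (snd vx)))) \<rightarrow>\<^sub>M count_space UNIV"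
    using measurable_component_singleton[of q UNIV "\<lambda>vx. measure_pmf (pmf_of_set (nbrs E (snd vx)))"] by simp
  show "(\<lambda>\<omega>. fst \<omega> v) \<in> brw_space p E \<rightarrow>\<^sub>M count_space UNIV"
    "(\<lambda>\<omega>. snd \<omega> q) \<in> brw_space p E \<rightarrow>\<^sub>M count_space UNIV"
    unfolding brw_space_def using measurable_compose[OF measurable_fst 1] measurable_compose[OF measurable_snd 2]
    by (auto simp: comp_def)
qed

lemma measurable_brw_spaceI:
  assumes "\<And>v. (\<lambda>\<omega>. fst (f \<omega>) v) \<in> M \<rightarrow>\<^sub>M count_space UNIV"
    and "\<And>q. (\<lambda>\<omega>. snd (f \<omega>) q) \<in> M \<rightarrow>\<^sub>M count_space UNIV"
  shows "f \<in> M \<rightarrow>\<^sub>M brw_space p E"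
proof -
  have "(\<lambda>\<omega>. (fst (f \<omega>), snd (f \<omega>))) \<in> M \<rightarrow>\<^sub>M brw_space p E"
    unfolding brw_space_def
    by (intro measurable_Pair measurable_PiM_single')
       (use assms in \<open>auto simp: space_PiM PiE_iff cong: measurable_cong_sets\<close>)
  then show ?thesis by simp
qed

lemma measurable_subtree [measurable]: "subtree i \<in> brw_space p E \<rightarrow>\<^sub>M brw_space p E"
  by (rule measurable_brw_spaceI) (auto simp: subtree_def)

section \<open>Integration over the first generation\<close>

lemma measurable_pair_of_sum:
  "(\<lambda>\<omega>. (\<lambda>v. \<omega> (Inl v), \<lambda>q. \<omega> (Inr q))) \<in> PiM UNIV (brw_law p E) \<rightarrow>\<^sub>M brw_space p E"
  by (rule measurable_brw_spaceI) (simp_all add: measurable_discrete_coord sets_brw_law)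

lemma nn_integral_brw_law:
  assumes "F \<in> borel_measurable (brw_space p E)"
  shows "(\<integral>\<^sup>+\<omega>. F \<omega> \<partial>brw_space p E) = (\<integral>\<^sup>+\<omega>. F (\<lambda>v. \<omega> (Inl v), \<lambda>q. \<omega> (Inr q)) \<partial>PiM UNIV (brw_law p E))"
  using assms by (subst distr_brw_law[symmetric], subst nn_integral_distr[OF measurable_pair_of_sum]) simp_all

lemma AE_brw_spaceI:
  assumes "Measurable.pred (brw_space p E) Q"
    and "AE \<omega> in PiM UNIV (brw_law p E). Q (\<lambda>v. \<omega> (Inl v), \<lambda>q. \<omega> (Inr q))"
  shows "AE \<omega> in brw_space p E. Q \<omega>"
  using assms by (subst distr_brw_law[symmetric], subst AE_distr_iff[OF measurable_pair_of_sum]) (auto simp: pred_def)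

text \<open>Markov property at a child: its position is a uniform neighbour of \<open>x\<close>, and
  the environment below it is an independent fresh copy.\<close>

lemma nn_integral_child_block:
  assumes F: "\<And>z. F z \<in> borel_measurable (brw_space p E)"
  defines "G \<equiv> \<lambda>\<eta>. F (\<eta> None) (\<lambda>v. \<eta> (Some (Inl v)), \<lambda>q. \<eta> (Some (Inr q)))"
  shows "G \<in> borel_measurable (PiM UNIV (\<lambda>j. brw_law p E (child_coord i x j)))"
    and "(\<integral>\<^sup>+\<eta>. G \<eta> \<partial>PiM UNIV (\<lambda>j. brw_law p E (child_coord i x j))) =
      (\<integral>\<^sup>+z. \<integral>\<^sup>+\<omega>. F z \<omega> \<partial>brw_space p E \<partial>nbr_pmf E x)"
proof -
  let ?K = "\<lambda>j. brw_law p E (child_coord i x j)"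
  have c: "(\<lambda>\<omega>. \<omega> c) \<in> PiM UNIV ?K \<rightarrow>\<^sub>M count_space UNIV" for c
    by (rule measurable_discrete_coord) (simp add: sets_brw_law)
  have m1: "(\<lambda>\<eta>. (\<lambda>v. \<eta> (Some (Inl v)), \<lambda>q. \<eta> (Some (Inr q)))) \<in> PiM UNIV ?K \<rightarrow>\<^sub>M brw_space p E"
    by (rule measurable_brw_spaceI) (simp_all add: c)
  \<comment> \<open>Positions are countable, so measurability for each fixed position
    suffices.\<close>
  show "G \<in> borel_measurable (PiM UNIV ?K)"
    unfolding G_def using measurable_compose[OF m1 F] c
    by (rule measurable_compose_countable)
  have m3: "(\<lambda>(z, \<omega>). F z (\<lambda>v. \<omega> (Inl v), \<lambda>q. \<omega> (Inr q))) \<in> borel_measurable (nbr_pmf E x \<Otimes>\<^sub>M PiM UNIV (brw_law p E))"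
  proof -
    have "(\<lambda>\<eta>. F (fst \<eta>) (\<lambda>v. snd \<eta> (Inl v), \<lambda>q. snd \<eta> (Inr q))) \<in> borel_measurable (nbr_pmf E x \<Otimes>\<^sub>M PiM UNIV (brw_law p E))"
    proof (rule measurable_compose_countable)
      show "(\<lambda>\<eta>. F z (\<lambda>v. snd \<eta> (Inl v), \<lambda>q. snd \<eta> (Inr q))) \<in> borel_measurable (nbr_pmf E x \<Otimes>\<^sub>M PiM UNIV (brw_law p E))" for z
        by (rule measurable_compose[OF measurable_snd measurable_compose[OF measurable_pair_of_sum F]])
      show "fst \<in> nbr_pmf E x \<Otimes>\<^sub>M PiM UNIV (brw_law p E) \<rightarrow>\<^sub>M count_space UNIV"
        using measurable_fst[of "measure_pmf (nbr_pmf E x)"] by (simp cong: measurable_cong_sets)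
    qed
    then show ?thesis by (simp add: split_beta)
  qed
  have "(\<integral>\<^sup>+\<eta>. G \<eta> \<partial>PiM UNIV ?K) =
    (\<integral>\<^sup>+z. \<integral>\<^sup>+\<omega>. F z (\<lambda>v. \<omega> (Inl v), \<lambda>q. \<omega> (Inr q)) \<partial>PiM UNIV (brw_law p E) \<partial>nbr_pmf E x)"
    unfolding G_def using nn_integral_PiM_coord_block[where K="?K" and f=Some and c=None
      and F="\<lambda>z \<omega>. F z (\<lambda>v. \<omega> (Inl v), \<lambda>q. \<omega> (Inr q))"] m3
    by (simp add: brw_law_child_coord prob_space_brw_law inj_def)
  also have "\<dots> = (\<integral>\<^sup>+z. \<integral>\<^sup>+\<omega>. F z \<omega> \<partial>brw_space p E \<partial>nbr_pmf E x)"
    by (simp add: nn_integral_brw_law[OF F])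
  finally show "(\<integral>\<^sup>+\<eta>. G \<eta> \<partial>PiM UNIV ?K) = (\<integral>\<^sup>+z. \<integral>\<^sup>+\<omega>. F z \<omega> \<partial>brw_space p E \<partial>nbr_pmf E x)" .
qed

text \<open>Branching property: the offspring number of the root and the data of children 0 and 1
  are independent. The environment has entries for both children whether or not they belong to the
  tree, so no case distinction arises.\<close>

lemma nn_integral_brw_branch:
  fixes a :: "nat \<Rightarrow> ennreal"
  assumes F0: "\<And>z. F0 z \<in> borel_measurable (brw_space p E)"
    and F1: "\<And>z. F1 z \<in> borel_measurable (brw_space p E)"
  shows "(\<integral>\<^sup>+\<omega>. a (fst \<omega> []) * (F0 (snd \<omega> ([0], x)) (subtree 0 \<omega>) * F1 (snd \<omega> ([1], x)) (subtree 1 \<omega>)) \<partial>brw_space p E)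
    = (\<integral>\<^sup>+n. a n \<partial>p) * ((\<integral>\<^sup>+z. \<integral>\<^sup>+\<omega>. F0 z \<omega> \<partial>brw_space p E \<partial>nbr_pmf E x) *
        (\<integral>\<^sup>+z. \<integral>\<^sup>+\<omega>. F1 z \<omega> \<partial>brw_space p E \<partial>nbr_pmf E x))"
proof -
  have [measurable]: "(\<lambda>\<omega>. F0 (snd \<omega> ([0], x)) (subtree 0 \<omega>)) \<in> borel_measurable (brw_space p E)"
     "(\<lambda>\<omega>. F1 (snd \<omega> ([1], x)) (subtree 1 \<omega>)) \<in> borel_measurable (brw_space p E)"
    by (rule measurable_compose_countable[where g="\<lambda>\<omega>. snd \<omega> ([_], x)"], rule measurable_compose[OF measurable_subtree], fact, measurable)+
  have [measurable]: "(\<lambda>\<omega>. a (fst \<omega> [])) \<in> borel_measurable (brw_space p E)"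
    by (rule measurable_compose[where N="count_space UNIV"]) auto
  let ?F = "\<lambda>\<omega>. a (fst \<omega> []) * (F0 (snd \<omega> ([0], x)) (subtree 0 \<omega>) * F1 (snd \<omega> ([1], x)) (subtree 1 \<omega>))"
  let ?G = "\<lambda>F \<eta>. F (\<eta> None) (\<lambda>v. \<eta> (Some (Inl v)), \<lambda>q. \<eta> (Some (Inr q)))"
  have "?F (\<lambda>v. \<omega> (Inl v), \<lambda>q. \<omega> (Inr q)) = a (\<omega> (Inl [])) *
     (?G F0 (\<lambda>j. \<omega> (child_coord 0 x j)) * ?G F1 (\<lambda>j. \<omega> (child_coord 1 x j)))" for \<omega>
    by (simp add: child_coord_def subtree_def)
  moreover have "?F \<in> borel_measurable (brw_space p E)" by measurable
  ultimately have "(\<integral>\<^sup>+\<omega>. ?F \<omega> \<partial>brw_space p E) = (\<integral>\<^sup>+\<omega>. a (\<omega> (Inl [])) *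
     (?G F0 (\<lambda>j. \<omega> (child_coord 0 x j)) * ?G F1 (\<lambda>j. \<omega> (child_coord 1 x j))) \<partial>PiM UNIV (brw_law p E))"
    by (subst nn_integral_brw_law) simp_all
  also have "\<dots> = (\<integral>\<^sup>+n. a n \<partial>brw_law p E (Inl [])) * ((\<integral>\<^sup>+z. \<integral>\<^sup>+\<omega>. F0 z \<omega> \<partial>brw_space p E \<partial>nbr_pmf E x) *
        (\<integral>\<^sup>+z. \<integral>\<^sup>+\<omega>. F1 z \<omega> \<partial>brw_space p E \<partial>nbr_pmf E x))"
    unfolding nn_integral_child_block(2)[OF F0, where i=0, symmetric] nn_integral_child_block(2)[OF F1, where i=1, symmetric]
  proof (rule nn_integral_PiM_coord_two_blocks)
    show "a \<in> borel_measurable (brw_law p E (Inl []))"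
      by (simp add: brw_law_def)
  qed (rule prob_space_brw_law inj_child_coord child_coord_disjoint root_notin_child_coord
        nn_integral_child_block(1)[OF F0] nn_integral_child_block(1)[OF F1])+
  also have "brw_law p E (Inl []) = measure_pmf p" by (simp add: brw_law_def)
  finally show ?thesis .
qed

subsection \<open>Simple random walk\<close>

definition avg :: "graph \<Rightarrow> (nat \<Rightarrow> real) \<Rightarrow> nat \<Rightarrow> real" where
  "avg E f x = (\<Sum>y\<in>nbrs E x. f y) / real (deg E x)"

text \<open>The \<open>n\<close>-step transition probability from \<open>x\<close> to
  \<open>y\<close>, as a power of the averaging operator applied to the indicator of
  \<open>y\<close>.\<close>

definition heat :: "graph \<Rightarrow> nat \<Rightarrow> nat \<Rightarrow> nat \<Rightarrow> real" where
  "heat E n x y = (avg E ^^ n) (\<lambda>z. of_bool (z = y)) x"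

lemma avg_mono: "(\<And>y. f y \<le> g y) \<Longrightarrow> avg E f x \<le> avg E g x"
  unfolding avg_def by (intro divide_right_mono sum_mono) auto

lemma avg_nonneg: "(\<And>y. 0 \<le> f y) \<Longrightarrow> 0 \<le> avg E f x"
  unfolding avg_def by (intro divide_nonneg_nonneg sum_nonneg) auto

lemma avg_cmult: "avg E (\<lambda>y. c * f y) x = c * avg E f x"
  by (simp add: avg_def sum_distrib_left)

lemma avg_multc: "avg E (\<lambda>y. f y * c) x = avg E f x * c"
  by (simp add: avg_def sum_distrib_right)

lemma avg_divide: "avg E (\<lambda>y. f y / c) x = avg E f x / c"
  using avg_cmult[of E "inverse c" f x] by (simp add: divide_inverse mult.commute)

lemma avg_sum: "avg E (\<lambda>y. \<Sum>k\<in>A. f k y) x = (\<Sum>k\<in>A. avg E (f k) x)"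
  by (simp add: avg_def sum_divide_distrib[symmetric] sum.swap[of _ A])

lemma avg_le_1: "(\<And>y. f y \<le> 1) \<Longrightarrow> avg E f x \<le> 1"
  using sum_mono[of "nbrs E x" f "\<lambda>_. 1"] by (simp add: avg_def deg_def divide_le_eq)

lemma heat_0: "heat E 0 x y = of_bool (x = y)"
  by (simp add: heat_def)

lemma heat_Suc: "heat E (Suc n) x y = avg E (\<lambda>z. heat E n z y) x"
  by (simp add: heat_def)

lemma heat_nonneg: "0 \<le> heat E n x y"
  by (induction n arbitrary: x) (auto simp: heat_0 heat_Suc intro!: avg_nonneg)

text \<open>Chapman-Kolmogorov over a finite set of intermediate vertices; the restriction turns
  equality into an upper bound and avoids infinite sums.\<close>

lemma sum_heat_mult_le:
  assumes "finite Y"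
  shows "(\<Sum>y\<in>Y. heat E i x y * heat E j y z) \<le> heat E (i + j) x z"
proof (induction i arbitrary: x)
  case 0
  have "(\<Sum>y\<in>Y. heat E 0 x y * heat E j y z) = (\<Sum>y\<in>Y. if y = x then heat E j y z else 0)"
    by (intro sum.cong) (auto simp: heat_0)
  then show ?case using assms by (simp add: heat_nonneg)
next
  case (Suc i)
  have "(\<Sum>y\<in>Y. heat E (Suc i) x y * heat E j y z) = avg E (\<lambda>w. \<Sum>y\<in>Y. heat E i w y * heat E j y z) x"
    by (simp add: heat_Suc avg_sum avg_multc)
  also have "\<dots> \<le> avg E (\<lambda>w. heat E (i + j) w z) x"
    by (rule avg_mono) (rule Suc.IH)
  finally show ?case by (simp add: heat_Suc)
qed

section \<open>Reversibility and Green sums in bounded degree\<close>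

locale bounded_graph =
  fixes E :: graph and D :: nat
  assumes good: "good_graph E D"
begin

lemma adj_sym: "E x y \<longleftrightarrow> E y x"
  using good by (auto simp: good_graph_def)

lemma nbrs_sym: "y \<in> nbrs E x \<longleftrightarrow> x \<in> nbrs E y"
  using adj_sym by (simp add: nbrs_def)

lemma finite_nbrs [simp]: "finite (nbrs E x)"
  using good by (simp add: good_graph_def)

lemma deg_le: "deg E x \<le> D"
  using good by (simp add: good_graph_def)

lemma nbrs_nonempty: "nbrs E x \<noteq> {}"
proof -
  have "(x, Suc x) \<in> {(a, b). E a b}\<^sup>*" using good by (simp add: good_graph_def)
  then show ?thesis by (cases rule: converse_rtranclE) (auto simp: nbrs_def)
qed

lemma deg_pos: "deg E x > 0"
  by (simp add: deg_def card_gt_0_iff nbrs_nonempty)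

lemma avg_const: "avg E (\<lambda>_. c) x = c"
  using nbrs_nonempty[of x] by (simp add: avg_def deg_def)

text \<open>Decomposition at the last step, complementing the first-step recursion
  \<open>heat_Suc\<close>.\<close>

lemma heat_Suc': "heat E (Suc n) x y = (\<Sum>z\<in>nbrs E y. heat E n x z / deg E z)"
proof (induction n arbitrary: x)
  case 0
  have "heat E 1 x y = (\<Sum>w\<in>nbrs E x. if w = y then 1 else 0) / deg E x"
    by (simp add: heat_Suc heat_0 avg_def of_bool_def)
  also have "\<dots> = (\<Sum>z\<in>nbrs E y. if z = x then 1 / deg E z else 0)"
    using nbrs_sym by simp
  also have "\<dots> = (\<Sum>z\<in>nbrs E y. heat E 0 x z / deg E z)"
    by (intro sum.cong) (auto simp: heat_0)
  finally show ?case by simp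
next
  case (Suc n)
  have "heat E (Suc (Suc n)) x y = avg E (\<lambda>w. \<Sum>z\<in>nbrs E y. heat E n w z / deg E z) x"
    by (subst heat_Suc) (simp only: Suc.IH)
  then show ?case by (simp add: avg_sum avg_divide heat_Suc)
qed

text \<open>Degrees form a reversing measure: in the induction a first step on one side becomes a
  last step on the other.\<close>

lemma heat_reversible: "real (deg E x) * heat E n x y = real (deg E y) * heat E n y x"
proof (induction n arbitrary: x y)
  case 0 then show ?case by (auto simp: heat_0)
next
  case (Suc n)
  have "real (deg E x) * heat E (Suc n) x y = (\<Sum>z\<in>nbrs E x. heat E n z y)"
    using deg_pos[of x] by (simp add: heat_Suc avg_def)
  also have "\<dots> = (\<Sum>z\<in>nbrs E x. real (deg E y) * (heat E n y z / deg E z))"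
  proof (intro sum.cong refl)
    fix z show "heat E n z y = real (deg E y) * (heat E n y z / deg E z)"
      using Suc.IH[of z y] deg_pos[of z] by (simp add: field_simps)
  qed
  finally show ?case by (simp add: heat_Suc'[of n y x] sum_distrib_left)
qed

lemma heat_le_deg_mult: "heat E n x y \<le> D * heat E n y x"
proof -
  have "heat E n x y \<le> real (deg E x) * heat E n x y"
    using deg_pos[of x] heat_nonneg[of E n x y] by (simp add: mult_le_cancel_right1)
  also have "\<dots> \<le> D * heat E n y x"
    unfolding heat_reversible[of x n y] using deg_le heat_nonneg by (intro mult_right_mono) auto
  finally show ?thesis .
qed

end

lemma sum_power_le:
  fixes l :: real assumes "0 \<le> l" "l < 1"
  shows "(\<Sum>k<m. l ^ k) \<le> 1 / (1 - l)"
  using assms sum_le_suminf[of "\<lambda>k. l ^ k" "{..<m}"] by (simp add: suminf_geometric summable_geometric)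

context bounded_graph
begin

text \<open>The squared Green sum counts meetings of two independent walks. Expanding it over both
  times and reversing one walk at cost \<open>D\<close> closes the path into a return to
  \<open>x\<close>, which decays geometrically. Time zero is left out because the occupation
  recursion treats the starting point separately.\<close>

lemma green_bounds:
  assumes l: "0 \<le> l" "l < 1" and le: "\<And>x n. heat E n x x \<le> l ^ n"
  shows "(\<Sum>k<m. heat E (Suc k) x x) \<le> 1 / (1 - l)"
    and "finite Y \<Longrightarrow> (\<Sum>y\<in>Y. (\<Sum>k<m. heat E (Suc k) x y)\<^sup>2) \<le> D / (1 - l)\<^sup>2"
proof -
  have pS: "l ^ Suc k \<le> l ^ k" for k using l by (intro power_decreasing) auto
  have "(\<Sum>k<m. heat E (Suc k) x x) \<le> (\<Sum>k<m. l ^ k)"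
    by (intro sum_mono) (use le pS order.trans in blast)
  also have "\<dots> \<le> 1 / (1 - l)" by (rule sum_power_le[OF l])
  finally show "(\<Sum>k<m. heat E (Suc k) x x) \<le> 1 / (1 - l)" .
  assume Y: "finite Y"
  have "(\<Sum>y\<in>Y. (\<Sum>k<m. heat E (Suc k) x y)\<^sup>2) = (\<Sum>i<m. \<Sum>j<m. \<Sum>y\<in>Y. heat E (Suc i) x y * heat E (Suc j) x y)"
    unfolding power2_eq_square sum_product
    by (subst sum.swap) (intro sum.cong refl sum.swap)
  also have "\<dots> \<le> (\<Sum>i<m. \<Sum>j<m. \<Sum>y\<in>Y. D * (heat E (Suc i) x y * heat E (Suc j) y x))"
    using mult_left_mono[OF heat_le_deg_mult heat_nonneg] by (intro sum_mono) (simp add: mult_ac)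
  also have "\<dots> = (\<Sum>i<m. \<Sum>j<m. D * (\<Sum>y\<in>Y. (heat E (Suc i) x y * heat E (Suc j) y x)))"
    by (simp add: sum_distrib_left)
  also have "\<dots> \<le> (\<Sum>i<m. \<Sum>j<m. D * (l ^ i * l ^ j))"
  proof (intro sum_mono mult_left_mono)
    fix i j
    have "(\<Sum>y\<in>Y. (heat E (Suc i) x y * heat E (Suc j) y x)) \<le> heat E (Suc i + Suc j) x x"
      by (rule sum_heat_mult_le[OF Y])
    also have "\<dots> \<le> l ^ (Suc i + Suc j)" by (rule le)
    also have "\<dots> \<le> l ^ (i + j)" using l by (intro power_decreasing) auto
    finally show "(\<Sum>y\<in>Y. (heat E (Suc i) x y * heat E (Suc j) y x)) \<le> l ^ i * l ^ j" by (simp add: power_add)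
  qed simp
  also have "\<dots> = D * ((\<Sum>i<m. l ^ i) * (\<Sum>i<m. l ^ i))"
    by (simp add: sum_distrib_left[symmetric] sum_product)
  also have "\<dots> \<le> D * ((1 / (1 - l)) * (1 / (1 - l)))"
    using sum_power_le[OF l] l by (intro mult_left_mono mult_mono) (auto intro!: sum_nonneg)
  finally show "(\<Sum>y\<in>Y. (\<Sum>k<m. heat E (Suc k) x y)\<^sup>2) \<le> D / (1 - l)\<^sup>2"
    by (simp add: power2_eq_square)
qed

end

section \<open>Hitting probabilities, first returns and Dirichlet energy\<close>

fun hit :: "graph \<Rightarrow> nat \<Rightarrow> nat \<Rightarrow> nat \<Rightarrow> real" where
  "hit A r 0 x = of_bool (x = r)"
| "hit A r (Suc n) x = (if x = r then 1 else avg A (hit A r n) x)"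

lemma hit_root: "hit A r n r = 1"
  by (cases n) auto

lemma hit_bounds: "0 \<le> hit A r n x" "hit A r n x \<le> 1"
  by (induction n arbitrary: x) (auto intro!: avg_nonneg avg_le_1)

lemma hit_mono: "hit A r n x \<le> hit A r (Suc n) x"
proof (induction n arbitrary: x)
  case 0 then show ?case by (auto intro!: avg_nonneg)
next
  case (Suc n)
  then show ?case using avg_mono[of "hit A r n" "hit A r (Suc n)"] by auto
qed

text \<open>Within \<open>n\<close> steps \<open>r\<close> can be hit only from the ball of radius
  \<open>n\<close>, which is finite by local finiteness. The truncation thus makes hitting
  probabilities usable as test functions.\<close>

lemma finite_support_hit:
  assumes "\<And>x y. A x y \<Longrightarrow> A y x" "\<And>x. finite (nbrs A x)"
  shows "finite {x. hit A r n x \<noteq> 0}"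
proof (induction n)
  case 0
  have "{x. hit A r 0 x \<noteq> 0} = {r}" by auto
  then show ?case by simp
next
  case (Suc n)
  have "{x. hit A r (Suc n) x \<noteq> 0} \<subseteq> insert r (\<Union>y\<in>{x. hit A r n x \<noteq> 0}. nbrs A y)"
  proof
    fix x assume "x \<in> {x. hit A r (Suc n) x \<noteq> 0}"
    then have "x = r \<or> avg A (hit A r n) x \<noteq> 0" by (auto split: if_splits)
    moreover have "\<exists>y\<in>nbrs A x. hit A r n y \<noteq> 0" if "avg A (hit A r n) x \<noteq> 0"
      using that by (auto simp: avg_def intro: ccontr)
    ultimately show "x \<in> insert r (\<Union>y\<in>{x. hit A r n x \<noteq> 0}. nbrs A y)"
      using assms(1) by (auto simp: nbrs_def)
  qed
  then show ?case by (rule finite_subset) (use Suc assms(2) in simp)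
qed

text \<open>A first visit to \<open>r\<close> at a positive time up to \<open>n + 1\<close> is one
  step followed by a hit within \<open>n\<close> steps.\<close>

lemma sum_first_ret: "(\<Sum>k\<le>Suc n. first_ret A r k x) = avg A (hit A r n) x"
proof (induction n arbitrary: x)
  case 0
  show ?case by (simp add: avg_def sum_divide_distrib of_bool_def if_distrib if_distribR cong: if_cong)
next
  case (Suc n)
  \<comment> \<open>If the first step lands on \<open>r\<close>, only \<open>j = 0\<close>
    contributes; otherwise the induction hypothesis applies at \<open>y\<close>.\<close>
  have hit_eq: "(\<Sum>j\<le>Suc n. if y = r then (if j = 0 then 1 else 0) else first_ret A r j y) = hit A r (Suc n) y" for y
  proof (cases "y = r")
    case True
    then show ?thesis by simp
  next
    case False
    then show ?thesis using Suc.IH[of y] by simp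
  qed
  have "(\<Sum>k\<le>Suc (Suc n). first_ret A r k x) = (\<Sum>j\<le>Suc n. first_ret A r (Suc j) x)"
    by (subst sum.atMost_Suc_shift) simp
  also have "\<dots> = (\<Sum>y\<in>nbrs A x. \<Sum>j\<le>Suc n. (1 / real (deg A x)) *
      (if y = r then (if j = 0 then 1 else 0) else first_ret A r j y))"
    by (simp only: first_ret.simps) (rule sum.swap)
  also have "\<dots> = (\<Sum>y\<in>nbrs A x. (1 / real (deg A x)) * hit A r (Suc n) y)"
    by (simp only: sum_distrib_left[symmetric] hit_eq)
  finally show ?case by (simp add: avg_def sum_divide_distrib)
qed

lemma first_ret_nonneg: "0 \<le> first_ret A r n x"
  by (induction n arbitrary: x) (auto intro!: sum_nonneg)

text \<open>The assumption bounds the probability of not returning within \<open>n + 1\<close> steps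
  below by \<open>1 / B\<close>, uniformly in \<open>n\<close>.\<close>

lemma srw_transientI:
  assumes "\<And>n. 1 \<le> B * (1 - avg A (hit A r n) r)"
  shows "srw_transient A r"
proof -
  have B: "B > 0"
  proof (rule ccontr)
    assume "\<not> B > 0"
    moreover have "avg A (hit A r 0) r \<le> 1" by (rule avg_le_1) (rule hit_bounds)
    ultimately have "B * (1 - avg A (hit A r 0) r) \<le> 0" by (intro mult_nonpos_nonneg) auto
    with assms[of 0] show False by linarith
  qed
  have le: "avg A (hit A r n) r \<le> 1 - 1 / B" for n
    using assms[of n] B by (simp add: field_simps)
  have "(\<Sum>n. ennreal (first_ret A r n r)) \<le> ennreal (1 - 1 / B)"
  proof (rule suminf_le_const)
    fix n
    have "(\<Sum>k<n. first_ret A r k r) \<le> (\<Sum>k\<le>Suc n. first_ret A r k r)"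
      by (rule sum_mono2) (auto simp: first_ret_nonneg)
    with le[of n] have "(\<Sum>k<n. first_ret A r k r) \<le> 1 - 1 / B" by (simp only: sum_first_ret)
    then show "(\<Sum>k<n. ennreal (first_ret A r k r)) \<le> ennreal (1 - 1 / B)"
      by (simp add: sum_ennreal first_ret_nonneg ennreal_leI)
  qed simp
  also have "\<dots> < 1" using B by (simp add: ennreal_less_one_iff)
  finally show ?thesis by (simp add: srw_transient_def)
qed

text \<open>Green's formula. Off \<open>r\<close> the function \<open>u\<close> is subharmonic, so
  only the term at \<open>r\<close>, an escape probability, contributes positively. The factor 2
  appears because \<open>W\<close> contains both orientations of each edge.\<close>

lemma dirichlet_energy_hit:
  fixes A :: graph and r n :: nat
  assumes sym: "\<And>x y. A x y \<Longrightarrow> A y x" and fin: "\<And>x. finite (nbrs A x)"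
  defines "u \<equiv> hit A r n"
  defines "W \<equiv> {(a, b). A a b \<and> (u a \<noteq> 0 \<or> u b \<noteq> 0)}"
  shows "finite W"
    and "(\<Sum>(a, b)\<in>W. (u a - u b)\<^sup>2) \<le> 2 * deg A r * (1 - avg A u r)"
proof -
  define S where "S = {a. u a \<noteq> 0}"
  have finS: "finite S" unfolding S_def u_def by (rule finite_support_hit[OF sym fin])
  have rS: "r \<in> S" by (simp add: S_def u_def hit_root)
  define W1 where "W1 = (SIGMA a:S. nbrs A a)"
  have finW1: "finite W1" unfolding W1_def using finS fin by auto
  have sub: "W1 \<subseteq> W" by (auto simp: W1_def W_def S_def nbrs_def)
  \<comment> \<open>\<open>W1\<close> consists of the edges starting in the finite support of
    \<open>u\<close>; reversing them yields the rest of \<open>W\<close>.\<close>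
  have Weq: "W = W1 \<union> prod.swap ` W1"
    using sym by (auto simp: W1_def W_def S_def nbrs_def image_iff)
  show finW: "finite W" unfolding Weq using finW1 by simp
  have swapW: "prod.swap ` W = W" using sym by (auto simp: W_def image_iff)
  have eq1: "(\<Sum>(a, b)\<in>W. u b * (u b - u a)) = (\<Sum>(a, b)\<in>W. u a * (u a - u b))"
  proof -
    have "(\<Sum>(a, b)\<in>prod.swap ` W. u b * (u b - u a)) = (\<Sum>(a, b)\<in>W. u a * (u a - u b))"
      by (subst sum.reindex) (auto simp: split_beta)
    then show ?thesis by (simp only: swapW)
  qed
  have pt: "real (deg A a) * (u a - avg A u a) = (\<Sum>b\<in>nbrs A a. u a - u b)" for a
  proof (cases "deg A a = 0")
    case True
    then have "nbrs A a = {}" using fin by (simp add: deg_def)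
    then show ?thesis by (simp add: True)
  next
    case False
    then show ?thesis by (simp add: avg_def sum_subtractf right_diff_distrib) (simp add: deg_def)
  qed
  \<comment> \<open>Monotonicity in the time horizon gives subharmonicity: off \<open>r\<close>, the
    average of \<open>u\<close> is the hitting probability with one more step.\<close>
  have term_le: "u a * (real (deg A a) * (u a - avg A u a)) \<le> 0" if "a \<noteq> r" for a
  proof -
    have "u a \<le> avg A u a" using hit_mono[of A r n a] that by (simp add: u_def)
    moreover have "0 \<le> u a" by (simp add: u_def hit_bounds)
    ultimately show ?thesis by (intro mult_nonneg_nonpos mult_nonneg_nonpos) auto
  qed
  \<comment> \<open>Edges starting outside the support contribute zero, which allows summation
    vertex by vertex.\<close>
  have "(\<Sum>(a, b)\<in>W. u a * (u a - u b)) = (\<Sum>(a, b)\<in>W1. u a * (u a - u b))"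
    by (rule sum.mono_neutral_right[OF finW sub]) (auto simp: W1_def W_def S_def nbrs_def)
  also have "(\<Sum>(a, b)\<in>W1. u a * (u a - u b)) = (\<Sum>a\<in>S. \<Sum>b\<in>nbrs A a. u a * (u a - u b))"
    unfolding W1_def by (rule sum.Sigma[symmetric]) (use finS fin in auto)
  finally have "(\<Sum>(a, b)\<in>W. u a * (u a - u b)) = (\<Sum>a\<in>S. u a * (real (deg A a) * (u a - avg A u a)))"
    by (simp only: pt sum_distrib_left)
  also have "\<dots> = u r * (real (deg A r) * (u r - avg A u r)) + (\<Sum>a\<in>S - {r}. u a * (real (deg A a) * (u a - avg A u a)))"
    by (rule sum.remove[OF finS rS])
  also have "\<dots> \<le> u r * (real (deg A r) * (u r - avg A u r)) + 0"
    by (intro add_left_mono sum_nonpos term_le) auto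
  also have "\<dots> = deg A r * (1 - avg A u r)" by (simp add: u_def hit_root)
  finally have le: "(\<Sum>(a, b)\<in>W. u a * (u a - u b)) \<le> deg A r * (1 - avg A u r)" .
  have "(\<Sum>(a, b)\<in>W. (u a - u b)\<^sup>2) = (\<Sum>(a, b)\<in>W. u a * (u a - u b)) + (\<Sum>(a, b)\<in>W. u b * (u b - u a))"
    by (subst sum.distrib[symmetric]) (intro sum.cong, auto simp: power2_eq_square algebra_simps)
  with eq1 le show "(\<Sum>(a, b)\<in>W. (u a - u b)\<^sup>2) \<le> 2 * deg A r * (1 - avg A u r)" by simp
qed

subsection \<open>Decay of the heat kernel\<close>

context bounded_graph
begin

lemma avg_ge_nbr:
  assumes "E y z" "\<And>w. 0 \<le> f w"
  shows "f z / D \<le> avg E f y"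
proof -
  have "f z \<le> (\<Sum>w\<in>nbrs E y. f w)"
    by (rule member_le_sum) (use assms in \<open>simp_all, simp add: nbrs_def\<close>)
  then show ?thesis
    unfolding avg_def using assms(2) deg_pos[of y] deg_le[of y] by (intro frac_le) (auto intro: sum_nonneg)
qed

text \<open>Here \<open>h n x\<close> stands for the probability that the walk from \<open>x\<close>
  visits \<open>r\<close> in generation \<open>n\<close> or later. Two children with success
  probability \<open>t\<close> each succeed with probability \<open>2 * t - t * t\<close>; mixing
  this with a single child with weight \<open>q\<close> produces \<open>step\<close>. If the kernel
  were too large, a subsolution would stay below every \<open>h n\<close>.\<close>

lemma heat_diag_le_of_survival:
  fixes h :: "nat \<Rightarrow> nat \<Rightarrow> real" and q :: real
  assumes q: "0 < q" "q \<le> 1"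
    and h: "\<And>n x. 0 \<le> h n x" "\<And>n x. h n x \<le> 1"
    and dec: "\<And>n x. h (Suc n) x \<le> h n x"
    and step: "\<And>n x. avg E (h n) x + q * (avg E (h n) x * (1 - avg E (h n) x)) \<le> h (Suc n) x"
    and root: "h 0 r = 1" and lim: "(\<lambda>n. h n r) \<longlonglongrightarrow> 0"
  shows "heat E N x x \<le> (1 / (1 + q / 2)) ^ N"
proof (rule ccontr)
  define l where "l = 1 / (1 + q / 2)"
  have l: "0 < l" "l < 1" "l * (1 + q / 2) = 1" using q by (auto simp: l_def field_simps)
  assume "\<not> heat E N x x \<le> (1 / (1 + q / 2)) ^ N"
  then have big: "l ^ N < heat E N x x" by (simp add: l_def)
  have N: "N > 0" using big by (cases N) (auto simp: heat_0)
  have dec': "h (n + k) y \<le> h n y" for n k y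
    by (induction k) (auto intro: order.trans[OF dec])
  have avg01: "0 \<le> avg E (h n) y" "avg E (h n) y \<le> 1" for n y
    using h by (auto intro: avg_nonneg avg_le_1)
  have avg_le: "avg E (h n) y \<le> h (Suc n) y" for n y
  proof -
    have "0 \<le> q * (avg E (h n) y * (1 - avg E (h n) y))"
      using q avg01[of n y] by (intro mult_nonneg_nonneg) auto
    then show ?thesis using step[of n y] by linarith
  qed
  have Dpos: "D > 0" using deg_pos[of x] deg_le[of x] by linarith
  \<comment> \<open>Connectivity transfers lower bounds between vertices, at the price of a factor
    and a time shift that do not depend on \<open>n\<close>.\<close>
  have path: "\<exists>c>0. \<exists>k. \<forall>n. c * h n z \<le> h (n + k) y" if "(y, z) \<in> {(a, b). E a b}\<^sup>*" for y z
    using that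
  proof (induction rule: converse_rtrancl_induct)
    case base
    show ?case by (intro exI[of _ 1] conjI exI[of _ 0]) auto
  next
    case (step y w)
    then obtain c k where c: "c > 0" "\<And>n. c * h n z \<le> h (n + k) w" by auto
    have "c / D * h n z \<le> h (n + Suc k) y" for n
    proof -
      have "c / D * h n z \<le> h (n + k) w / D" using c(2)[of n] Dpos by (simp add: divide_right_mono)
      also have "\<dots> \<le> avg E (h (n + k)) y" by (rule avg_ge_nbr) (use step h in auto)
      also have "\<dots> \<le> h (n + Suc k) y" using avg_le[of "n + k" y] by simp
      finally show ?thesis .
    qed
    then show ?case using c(1) Dpos by (intro exI[of _ "c / D"] conjI exI[of _ "Suc k"]) auto
  qed
  have conn: "(y, z) \<in> {(a, b). E a b}\<^sup>*" for y z using good by (simp add: good_graph_def)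
  have h0: "0 < h 0 x"
  proof -
    obtain c k where "c > 0" "\<And>n. c * h n r \<le> h (n + k) x" using path[OF conn] by blast
    from this(1) this(2)[of 0] dec'[of 0 k x] show ?thesis by (simp add: root)
  qed
  \<comment> \<open>Without the branching gain, \<open>h\<close> still dominates the iterates of the
    plain random walk.\<close>
  have iter: "heat E k y x * h 0 x \<le> h k y" for k y
  proof (induction k arbitrary: y)
    case 0 then show ?case using h by (auto simp: heat_0)
  next
    case (Suc k)
    have "heat E (Suc k) y x * h 0 x = avg E (\<lambda>w. heat E k w x * h 0 x) y"
      by (simp add: heat_Suc avg_multc)
    also have "\<dots> \<le> avg E (h k) y" by (rule avg_mono) (rule Suc.IH)
    also have "\<dots> \<le> h (Suc k) y" by (rule avg_le)
    finally show ?case .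
  qed
  define \<phi> where "\<phi> y = (\<Sum>k<N. heat E k y x / l ^ k)" for y
  define Z where "Z = (\<Sum>k<N. 1 / l ^ k)"
  \<comment> \<open>Division by \<open>Z\<close> puts \<open>e * \<phi>\<close> below
    \<open>h 0\<close>. The further 2 keeps it at most 1/2, where branching gains a factor of at
    least \<open>1 + q / 2\<close>.\<close>
  define e where "e = h 0 x / (2 * Z)"
  have Z: "Z > 0" unfolding Z_def using l N by (intro sum_pos) auto
  have e: "e > 0" using h0 Z by (simp add: e_def)
  have \<phi>_le: "e * \<phi> y \<le> h 0 y / 2" for y
  proof -
    have "\<phi> y * h 0 x = (\<Sum>k<N. heat E k y x * h 0 x / l ^ k)"
      by (simp add: \<phi>_def sum_distrib_right)
    also have "\<dots> \<le> (\<Sum>k<N. h 0 y / l ^ k)"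
      using iter[of _ y] dec'[of 0 _ y] l by (intro sum_mono divide_right_mono) (auto intro: order.trans)
    also have "\<dots> = h 0 y * Z" by (simp add: Z_def sum_distrib_left)
    finally show ?thesis using Z by (simp add: e_def field_simps)
  qed
  \<comment> \<open>Averaging shifts the sum by one index. The term that enters exceeds the one that
    leaves: at \<open>x\<close> by \<open>big\<close>, elsewhere because \<open>heat E 0 y x\<close>
    vanishes.\<close>
  have super: "l * \<phi> y \<le> avg E \<phi> y" for y
  proof -
    have "avg E \<phi> y = (\<Sum>k<N. heat E (Suc k) y x / l ^ k)"
      unfolding \<phi>_def by (simp add: avg_sum avg_divide heat_Suc)
    also have "\<dots> = l * (\<Sum>k<N. heat E (Suc k) y x / l ^ Suc k)"
      using l by (simp add: sum_distrib_left)
    also have "(\<Sum>k<N. heat E (Suc k) y x / l ^ Suc k) = \<phi> y + (heat E N y x / l ^ N - heat E 0 y x)"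
      using sum.lessThan_Suc_shift[of "\<lambda>k. heat E k y x / l ^ k" N] by (simp add: \<phi>_def)
    also have "l * \<dots> \<ge> l * \<phi> y"
    proof -
      have "heat E 0 y x \<le> heat E N y x / l ^ N"
        using big l heat_nonneg[of E N y x] by (auto simp: heat_0 field_simps)
      then show ?thesis using l by (intro mult_left_mono) auto
    qed
    finally show ?thesis .
  qed
  have lower: "e * \<phi> y \<le> h n y" for n y
  proof (induction n arbitrary: y)
    case 0 then show ?case using \<phi>_le[of y] h(1)[of 0 y] by linarith
  next
    case (Suc n)
    define t where "t = avg E (h n) y"
    define c where "c = e * (l * \<phi> y)"
    have \<phi>0: "0 \<le> \<phi> y" unfolding \<phi>_def using l heat_nonneg by (intro sum_nonneg) auto
    have "e * avg E \<phi> y \<le> t"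
      unfolding t_def avg_cmult[symmetric] by (rule avg_mono) (rule Suc.IH)
    moreover have "c \<le> e * avg E \<phi> y"
      unfolding c_def using super[of y] e by (intro mult_left_mono) auto
    ultimately have ct: "c \<le> t" by linarith
    have "l * (e * \<phi> y) \<le> 1 * (e * \<phi> y)" using l e \<phi>0 by (intro mult_right_mono) auto
    then have c2: "c \<le> 1 / 2" using \<phi>_le[of y] h(2)[of 0 y] by (simp add: c_def mult_ac)
    have c0: "0 \<le> c" using e l \<phi>0 by (simp add: c_def)
    have t1: "t \<le> 1" using avg01 by (simp add: t_def)
    \<comment> \<open>The choice of \<open>l\<close> makes the branching gain exactly repay the
      factor \<open>l\<close> lost by averaging.\<close>
    have "e * \<phi> y = (l * (1 + q / 2)) * (e * \<phi> y)" by (simp add: l)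
    also have "\<dots> = c + q * (c * (1 / 2))" by (simp add: c_def algebra_simps)
    also have "\<dots> \<le> c + q * (c * (1 - c))"
      using c0 c2 q by (intro add_left_mono mult_left_mono) auto
    also have "\<dots> \<le> t + q * (t * (1 - t))"
    proof -
      \<comment> \<open>This product is the difference of the two sides, so it expresses
        monotonicity of the branching map between \<open>c\<close> and \<open>t\<close>.\<close>
      have "0 \<le> (t - c) * (1 + q * (1 - t - c))"
      proof (intro mult_nonneg_nonneg)
        have "q * (- 1) \<le> q * (1 - t - c)" using q t1 c2 by (intro mult_left_mono) auto
        then show "0 \<le> 1 + q * (1 - t - c)" using q by simp
      qed (use ct in simp)
      then show ?thesis by (simp add: algebra_simps)
    qed
    also have "\<dots> \<le> h (Suc n) y" unfolding t_def by (rule step)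
    finally show ?case .
  qed
  have "1 \<le> \<phi> x"
  proof -
    have "heat E 0 x x / l ^ 0 \<le> \<phi> x"
      unfolding \<phi>_def using N l heat_nonneg by (intro member_le_sum[where f="\<lambda>k. heat E k x x / l ^ k"]) auto
    then show ?thesis by (simp add: heat_0)
  qed
  then have "e * 1 \<le> e * \<phi> x" using e by (intro mult_left_mono) auto
  then have lowx: "e \<le> h n x" for n using lower[of x n] by simp
  \<comment> \<open>The uniform lower bound at \<open>x\<close> is carried back to \<open>r\<close>,
    where it contradicts \<open>lim\<close>.\<close>
  obtain c k where c: "c > 0" "\<And>n. c * h n x \<le> h (n + k) r" using path[OF conn] by blast
  have "c * e \<le> h (n + k) r" for n
  proof -
    have "c * e \<le> c * h n x" using lowx c(1) by (intro mult_left_mono) auto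
    with c(2)[of n] show ?thesis by linarith
  qed
  moreover have "(\<lambda>n. h (n + k) r) \<longlonglongrightarrow> 0" using lim by (rule LIMSEQ_ignore_initial_segment)
  ultimately have "c * e \<le> 0" by (intro LIMSEQ_le_const) auto
  with c(1) e show False by (simp add: mult_le_0_iff)
qed

end

subsection \<open>The uniform flow through the family tree\<close>

text \<open>Only children 0 and 1 receive flow: theirs are the subtrees whose independence has been
  established.\<close>

definition branch_avg :: "brw \<Rightarrow> (nat \<Rightarrow> real) \<Rightarrow> real" where
  "branch_avg \<omega> f = (if fst \<omega> [] < 2 then f 0 else (f 0 + f 1) / 2)"

text \<open>The share of a unit flow started at \<open>x\<close> that sits at \<open>y\<close> in
  generation \<open>n\<close>; \<open>occupation\<close> adds up the generations before
  \<open>n\<close>.\<close>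

fun level_mass :: "nat \<Rightarrow> brw \<Rightarrow> nat \<Rightarrow> nat \<Rightarrow> real" where
  "level_mass 0 \<omega> x y = of_bool (x = y)"
| "level_mass (Suc n) \<omega> x y = branch_avg \<omega> (\<lambda>i. level_mass n (subtree i \<omega>) (snd \<omega> ([i], x)) y)"

fun occupation :: "nat \<Rightarrow> brw \<Rightarrow> nat \<Rightarrow> nat \<Rightarrow> real" where
  "occupation 0 \<omega> x y = 0"
| "occupation (Suc n) \<omega> x y =
     of_bool (x = y) + branch_avg \<omega> (\<lambda>i. occupation n (subtree i \<omega>) (snd \<omega> ([i], x)) y)"

text \<open>The flow across the oriented edge \<open>e\<close> within the first \<open>n\<close>
  generations; crossings in opposite directions are recorded separately and not cancelled.\<close>

fun edge_flow :: "nat \<Rightarrow> brw \<Rightarrow> nat \<Rightarrow> nat \<times> nat \<Rightarrow> real" where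
  "edge_flow 0 \<omega> x e = 0"
| "edge_flow (Suc n) \<omega> x e = branch_avg \<omega> (\<lambda>i. of_bool ((x, snd \<omega> ([i], x)) = e)
     + edge_flow n (subtree i \<omega>) (snd \<omega> ([i], x)) e)"

lemma branch_avg_nonneg: "(\<And>i. 0 \<le> f i) \<Longrightarrow> 0 \<le> branch_avg \<omega> f"
  by (simp add: branch_avg_def)

lemma branch_avg_mono: "(\<And>i. f i \<le> g i) \<Longrightarrow> branch_avg \<omega> f \<le> branch_avg \<omega> g"
  by (simp add: branch_avg_def add_mono)

lemma branch_avg_add: "branch_avg \<omega> (\<lambda>i. f i + g i) = branch_avg \<omega> f + branch_avg \<omega> g"
  by (simp add: branch_avg_def field_simps)

lemma branch_avg_const: "branch_avg \<omega> (\<lambda>i. c) = c"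
  by (simp add: branch_avg_def)

lemma branch_avg_sum: "branch_avg \<omega> (\<lambda>i. \<Sum>k\<in>A. f k i) = (\<Sum>k\<in>A. branch_avg \<omega> (f k))"
  by (simp add: branch_avg_def sum.distrib sum_divide_distrib add_divide_distrib)

lemma branch_avg_multc: "branch_avg \<omega> (\<lambda>i. f i * c) = branch_avg \<omega> f * c"
  by (simp add: branch_avg_def algebra_simps)

lemma level_mass_nonneg: "0 \<le> level_mass n \<omega> x y"
  by (induction n arbitrary: \<omega> x) (simp_all add: branch_avg_nonneg)

lemma occupation_nonneg: "0 \<le> occupation n \<omega> x y"
  by (induction n arbitrary: \<omega> x) (simp_all add: branch_avg_nonneg)

lemma edge_flow_nonneg: "0 \<le> edge_flow n \<omega> x e"
  by (induction n arbitrary: \<omega> x) (simp_all add: branch_avg_nonneg)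

text \<open>The recursion of \<open>occupation\<close> peels off the first generation; this identity
  peels off the last.\<close>

lemma occupation_Suc: "occupation (Suc n) \<omega> x y = occupation n \<omega> x y + level_mass n \<omega> x y"
proof (induction n arbitrary: \<omega> x)
  case 0 show ?case by (simp add: branch_avg_const)
next
  case (Suc n)
  have "occupation (Suc (Suc n)) \<omega> x y = of_bool (x = y) + branch_avg \<omega> (\<lambda>i. occupation n (subtree i \<omega>) (snd \<omega> ([i], x)) y
      + level_mass n (subtree i \<omega>) (snd \<omega> ([i], x)) y)"
    by (subst occupation.simps(2)) (simp only: Suc.IH)
  then show ?case by (simp add: branch_avg_add)
qed

lemma occupation_eq_sum: "occupation n \<omega> x y = (\<Sum>k<n. level_mass k \<omega> x y)"
  by (induction n) (simp_all add: occupation_Suc del: occupation.simps(2))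

text \<open>Flow can leave \<open>a\<close> only after arriving there, and each tree step has a
  single target.\<close>

lemma sum_edge_flow_le:
  assumes "finite B"
  shows "(\<Sum>b\<in>B. edge_flow n \<omega> x (a, b)) \<le> occupation n \<omega> x a"
proof (induction n arbitrary: \<omega> x)
  case 0 show ?case by simp
next
  case (Suc n)
  have "(\<Sum>b\<in>B. edge_flow (Suc n) \<omega> x (a, b)) = branch_avg \<omega> (\<lambda>i. (\<Sum>b\<in>B. of_bool ((x, snd \<omega> ([i], x)) = (a, b)))
      + (\<Sum>b\<in>B. edge_flow n (subtree i \<omega>) (snd \<omega> ([i], x)) (a, b)))"
    by (simp only: edge_flow.simps branch_avg_sum[symmetric] sum.distrib)
  also have "\<dots> \<le> branch_avg \<omega> (\<lambda>i. of_bool (x = a) + occupation n (subtree i \<omega>) (snd \<omega> ([i], x)) a)"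
  proof (intro branch_avg_mono add_mono Suc.IH)
    fix i
    have "(\<Sum>b\<in>B. of_bool ((x, snd \<omega> ([i], x)) = (a, b))) = (\<Sum>b\<in>B. if b = snd \<omega> ([i], x) then of_bool (x = a) else (0::real))"
      by (intro sum.cong) auto
    also have "\<dots> \<le> of_bool (x = a)" using assms by simp
    finally show "(\<Sum>b\<in>B. of_bool ((x, snd \<omega> ([i], x)) = (a, b))) \<le> (of_bool (x = a) :: real)" .
  qed
  finally show ?case by (simp add: branch_avg_add branch_avg_const)
qed

section \<open>The image of the tree flow as a flow in the trace\<close>

lemma in_tree_append: "in_tree (fst \<omega>) (v @ [i]) \<longleftrightarrow> i < fst \<omega> [] \<and> in_tree (fst (subtree i \<omega>)) v"
  by (induction v) (auto simp: subtree_def)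

text \<open>Nodes are reversed lists, so a trailing \<open>i\<close> is the first move, from the
  root to child \<open>i\<close>. The relocated entries of \<open>subtree\<close> are never
  read.\<close>

lemma brw_pos_append: "brw_pos x (snd \<omega>) (v @ [i]) = brw_pos (snd \<omega> ([i], x)) (snd (subtree i \<omega>)) v"
  by (induction v) (auto simp: subtree_def)

lemma trace_first_edge: "i < fst \<omega> [] \<Longrightarrow> trace (fst \<omega>) (snd \<omega>) x x (snd \<omega> ([i], x))"
  unfolding trace_def by (intro exI[of _ i] exI[of _ "[]"]) simp

lemma trace_subtree:
  assumes "i < fst \<omega> []" "trace (fst (subtree i \<omega>)) (snd (subtree i \<omega>)) (snd \<omega> ([i], x)) a b"
  shows "trace (fst \<omega>) (snd \<omega>) x a b"
proof -
  obtain j v where v: "in_tree (fst (subtree i \<omega>)) (j # v)"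
    "{brw_pos (snd \<omega> ([i], x)) (snd (subtree i \<omega>)) v, brw_pos (snd \<omega> ([i], x)) (snd (subtree i \<omega>)) (j # v)} = {a, b}"
    using assms(2) unfolding trace_def by blast
  have "in_tree (fst \<omega>) (j # (v @ [i]))"
    using v(1) assms(1) in_tree_append[of \<omega> "j # v" i] by simp
  moreover have "{brw_pos x (snd \<omega>) (v @ [i]), brw_pos x (snd \<omega>) (j # (v @ [i]))} = {a, b}"
    using v(2) brw_pos_append[of x \<omega> v i] brw_pos_append[of x \<omega> "j # v" i] by simp
  ultimately show ?thesis unfolding trace_def by blast
qed

lemma trace_sym: "trace N J r a b \<Longrightarrow> trace N J r b a"
  by (auto simp: trace_def insert_commute)

lemma trace_imp_adj:
  assumes "trace N J r a b" and J: "\<And>v x. J (v, x) \<in> nbrs E x" and sym: "\<And>x y. E x y \<Longrightarrow> E y x"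
  shows "E a b"
  using assms(1) J[unfolded nbrs_def] sym by (auto simp: trace_def doubleton_eq_iff)

text \<open>Summation by parts: along each line of descent the potential drops telescope, and
  averaging over children preserves the identity. Positive offspring numbers ensure that flow uses
  only trace edges.\<close>

lemma edge_flow_potential:
  assumes W: "finite W" and S: "finite S" "\<And>y. y \<notin> S \<Longrightarrow> u y = 0"
  shows "(\<And>v. 0 < fst \<omega> v) \<Longrightarrow> (\<And>a b. trace (fst \<omega>) (snd \<omega>) x a b \<Longrightarrow> u a \<noteq> u b \<Longrightarrow> (a, b) \<in> W) \<Longrightarrow>
    u x = (\<Sum>e\<in>W. edge_flow n \<omega> x e * (u (fst e) - u (snd e))) + (\<Sum>y\<in>S. level_mass n \<omega> x y * u y)"
proof (induction n arbitrary: \<omega> x)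
  case 0
  have "(\<Sum>y\<in>S. level_mass 0 \<omega> x y * u y) = (\<Sum>y\<in>S. if y = x then u x else 0)"
    by (intro sum.cong) auto
  also have "\<dots> = u x" using S by auto
  finally show ?case by simp
next
  case (Suc n)
  let ?X = "\<lambda>i. snd \<omega> ([i], x)"
  have child: "u x = (\<Sum>e\<in>W. (of_bool ((x, ?X i) = e) + edge_flow n (subtree i \<omega>) (?X i) e) * (u (fst e) - u (snd e)))
      + (\<Sum>y\<in>S. level_mass n (subtree i \<omega>) (?X i) y * u y)" if i: "i < fst \<omega> []" for i
  proof -
    have "u (?X i) = (\<Sum>e\<in>W. edge_flow n (subtree i \<omega>) (?X i) e * (u (fst e) - u (snd e))) +
        (\<Sum>y\<in>S. level_mass n (subtree i \<omega>) (?X i) y * u y)"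
    proof (rule Suc.IH)
      show "0 < fst (subtree i \<omega>) v" for v using Suc.prems(1) by (simp add: subtree_def)
      show "(a, b) \<in> W" if "trace (fst (subtree i \<omega>)) (snd (subtree i \<omega>)) (?X i) a b" "u a \<noteq> u b" for a b
        using Suc.prems(2) trace_subtree[OF i that(1)] that(2) by blast
    qed
    moreover have "(\<Sum>e\<in>W. of_bool ((x, ?X i) = e) * (u (fst e) - u (snd e))) = u x - u (?X i)"
    proof -
      have "(\<Sum>e\<in>W. of_bool ((x, ?X i) = e) * (u (fst e) - u (snd e))) =
          (\<Sum>e\<in>W. if e = (x, ?X i) then u x - u (?X i) else 0)"
        by (intro sum.cong) auto
      \<comment> \<open>A trace edge missing from \<open>W\<close> has equal potentials at its ends,
        so both sides are zero in that case.\<close>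
      also have "\<dots> = u x - u (?X i)"
        using W Suc.prems(2)[OF trace_first_edge[OF i]] by auto
      finally show ?thesis .
    qed
    ultimately show ?thesis by (simp add: distrib_right sum.distrib)
  qed
  have "u x = branch_avg \<omega> (\<lambda>i. (\<Sum>e\<in>W. (of_bool ((x, ?X i) = e) + edge_flow n (subtree i \<omega>) (?X i) e) * (u (fst e) - u (snd e)))
      + (\<Sum>y\<in>S. level_mass n (subtree i \<omega>) (?X i) y * u y))" (is "_ = branch_avg \<omega> ?f")
  proof (cases "fst \<omega> [] < 2")
    case True
    have "u x = ?f 0" by (rule child) (rule Suc.prems(1))
    then show ?thesis unfolding branch_avg_def if_P[OF True] .
  next
    case False
    have "u x = ?f 0" "u x = ?f 1" by (rule child; use False in simp)+
    moreover have "a = (b + c) / 2" if "a = b" "a = c" for a b c :: real using that by simp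
    ultimately have "u x = (?f 0 + ?f 1) / 2" by blast
    then show ?thesis unfolding branch_avg_def if_not_P[OF False] .
  qed
  then show ?case by (simp only: branch_avg_add branch_avg_sum branch_avg_multc edge_flow.simps level_mass.simps)
qed

lemma sum_power2_le_power2_sum:
  fixes f :: "'a \<Rightarrow> real"
  assumes "finite A" "\<And>a. a \<in> A \<Longrightarrow> 0 \<le> f a"
  shows "(\<Sum>a\<in>A. (f a)\<^sup>2) \<le> (\<Sum>a\<in>A. f a)\<^sup>2"
proof -
  have "(\<Sum>a\<in>A. (f a)\<^sup>2) \<le> (\<Sum>a\<in>A. f a * (\<Sum>a\<in>A. f a))"
    unfolding power2_eq_square using assms by (intro sum_mono mult_left_mono member_le_sum) auto
  then show ?thesis by (simp add: power2_eq_square sum_distrib_right)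
qed

text \<open>Half of the method of finite-energy flows. Testing the flow against the hitting function
  \<open>u\<close> gives \<open>1 - R n\<close>; Cauchy-Schwarz bounds its square by flow energy
  times Dirichlet energy, and the latter is controlled by the escape probability.\<close>

lemma trace_transient:
  assumes N: "\<And>v. 0 < fst \<omega> v"
    and fin: "\<And>a. finite (nbrs (trace (fst \<omega>) (snd \<omega>) r) a)"
    and B: "\<And>n. (\<Sum>y<n. (occupation n \<omega> r y)\<^sup>2) \<le> B"
  shows "srw_transient (trace (fst \<omega>) (snd \<omega>) r) r"
proof (rule srw_transientI)
  fix k
  let ?A = "trace (fst \<omega>) (snd \<omega>) r"
  define u where "u = hit ?A r k"
  define S where "S = {x. u x \<noteq> 0}"
  define W where "W = {(a, b). ?A a b \<and> (u a \<noteq> 0 \<or> u b \<noteq> 0)}"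
  have finS: "finite S" unfolding S_def u_def by (rule finite_support_hit[OF trace_sym fin])
  have finW: "finite W" and energy: "(\<Sum>(a, b)\<in>W. (u a - u b)\<^sup>2) \<le> 2 * deg ?A r * (1 - avg ?A u r)"
    unfolding u_def W_def using dirichlet_energy_hit[OF trace_sym fin] by blast+
  define R where "R n = (\<Sum>y\<in>S. level_mass n \<omega> r y * u y)" for n
  have B0: "0 \<le> B" using B[of 0] by simp
  \<comment> \<open>Bounded squares bound the total occupation of each vertex, so the flow
    eventually leaves every finite set and \<open>R\<close> tends to zero.\<close>
  have summ: "summable (\<lambda>n. level_mass n \<omega> r y)" for y
  proof (rule summableI_nonneg_bounded)
    fix n
    have "(occupation n \<omega> r y)\<^sup>2 \<le> B"
    proof -
      \<comment> \<open>The bound \<open>B\<close> covers only vertices below the time index, so the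
        time is raised until \<open>y\<close> is included.\<close>
      let ?n = "max n (Suc y)"
      have "occupation n \<omega> r y \<le> occupation ?n \<omega> r y"
        unfolding occupation_eq_sum by (rule sum_mono2) (auto simp: level_mass_nonneg)
      then have "(occupation n \<omega> r y)\<^sup>2 \<le> (occupation ?n \<omega> r y)\<^sup>2"
        by (rule power_mono) (rule occupation_nonneg)
      also have "\<dots> \<le> (\<Sum>y<?n. (occupation ?n \<omega> r y)\<^sup>2)"
        by (rule member_le_sum) auto
      finally show ?thesis using B[of ?n] by linarith
    qed
    then show "(\<Sum>k<n. level_mass k \<omega> r y) \<le> sqrt B"
      unfolding occupation_eq_sum[symmetric] by (rule real_le_rsqrt)
  qed (rule level_mass_nonneg)
  have "R \<longlonglongrightarrow> (\<Sum>y\<in>S. 0 * u y)"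
    unfolding R_def by (intro tendsto_intros summable_LIMSEQ_zero summ)
  then have lim: "(\<lambda>n. (1 - R n)\<^sup>2) \<longlonglongrightarrow> 1"
    by (auto intro!: tendsto_eq_intros)
  \<comment> \<open>For \<open>n\<close> beyond \<open>m\<close>, all tails of edges in
    \<open>W\<close> lie in the vertex range covered by \<open>B\<close>.\<close>
  obtain m where m: "fst ` W \<subseteq> {..<m}"
    using finite_nat_bounded[of "fst ` W"] finW by auto
  have "(1 - R n)\<^sup>2 \<le> B * (2 * deg ?A r * (1 - avg ?A u r))" if n: "n \<ge> m" for n
  proof -
    have "u r = (\<Sum>e\<in>W. edge_flow n \<omega> r e * (u (fst e) - u (snd e))) + R n"
      unfolding R_def by (rule edge_flow_potential[OF finW finS]) (auto simp: S_def W_def N)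
    moreover have "u r = 1" by (simp add: u_def hit_root)
    ultimately have "1 - R n = (\<Sum>e\<in>W. edge_flow n \<omega> r e * (u (fst e) - u (snd e)))"
      by (simp only: diff_eq_eq)
    then have "(1 - R n)\<^sup>2 = (\<Sum>e\<in>W. edge_flow n \<omega> r e * (u (fst e) - u (snd e)))\<^sup>2"
      by (simp only:)
    also have "\<dots> \<le> (\<Sum>e\<in>W. (edge_flow n \<omega> r e)\<^sup>2) * (\<Sum>e\<in>W. (u (fst e) - u (snd e))\<^sup>2)"
      by (rule Cauchy_Schwarz_ineq_sum)
    also have "\<dots> \<le> B * (2 * deg ?A r * (1 - avg ?A u r))"
    proof (rule mult_mono)
      have "(\<Sum>e\<in>W. (edge_flow n \<omega> r e)\<^sup>2) \<le> (\<Sum>e\<in>{..<n} \<times> snd ` W. (edge_flow n \<omega> r e)\<^sup>2)"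
        using m n finW by (intro sum_mono2) (force simp: image_iff)+
      also have "\<dots> = (\<Sum>a<n. \<Sum>b\<in>snd ` W. (edge_flow n \<omega> r (a, b))\<^sup>2)"
        by (simp add: sum.cartesian_product)
      also have "\<dots> \<le> (\<Sum>a<n. (occupation n \<omega> r a)\<^sup>2)"
      proof (rule sum_mono)
        fix a
        have "(\<Sum>b\<in>snd ` W. (edge_flow n \<omega> r (a, b))\<^sup>2) \<le> (\<Sum>b\<in>snd ` W. edge_flow n \<omega> r (a, b))\<^sup>2"
          by (rule sum_power2_le_power2_sum) (use finW edge_flow_nonneg in auto)
        also have "\<dots> \<le> (occupation n \<omega> r a)\<^sup>2"
          using finW by (intro power_mono sum_edge_flow_le sum_nonneg edge_flow_nonneg) auto
        finally show "(\<Sum>b\<in>snd ` W. (edge_flow n \<omega> r (a, b))\<^sup>2) \<le> (occupation n \<omega> r a)\<^sup>2" .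
      qed
      also have "\<dots> \<le> B" by (rule B)
      finally show "(\<Sum>e\<in>W. (edge_flow n \<omega> r e)\<^sup>2) \<le> B" .
      show "(\<Sum>e\<in>W. (u (fst e) - u (snd e))\<^sup>2) \<le> 2 * deg ?A r * (1 - avg ?A u r)"
        using energy by (simp add: split_beta)
    qed (use B0 in \<open>auto intro: sum_nonneg\<close>)
    finally show ?thesis .
  qed
  then have "1 \<le> B * (2 * deg ?A r * (1 - avg ?A u r))"
    by (intro LIMSEQ_le_const2[OF lim]) blast
  then show "1 \<le> B * 2 * deg ?A r * (1 - avg ?A (hit ?A r k) r)"
    by (simp add: u_def mult_ac)
qed

subsection \<open>Moments of the occupation measure\<close>

text \<open>Visits in generation \<open>n\<close> or later, rather than exactly \<open>n\<close>, so
  that the events decrease in \<open>n\<close>.\<close>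

definition reaches :: "nat \<Rightarrow> nat \<Rightarrow> brw \<Rightarrow> nat \<Rightarrow> bool" where
  "reaches r n \<omega> x \<longleftrightarrow> (\<exists>v. n \<le> length v \<and> in_tree (fst \<omega>) v \<and> brw_pos x (snd \<omega>) v = r)"

lemma reaches_child:
  assumes "i < fst \<omega> []" "reaches r n (subtree i \<omega>) (snd \<omega> ([i], x))"
  shows "reaches r (Suc n) \<omega> x"
proof -
  obtain v where v: "n \<le> length v" "in_tree (fst (subtree i \<omega>)) v"
      "brw_pos (snd \<omega> ([i], x)) (snd (subtree i \<omega>)) v = r"
    using assms(2) by (auto simp: reaches_def)
  then show ?thesis unfolding reaches_def
    by (intro exI[of _ "v @ [i]"]) (simp add: in_tree_append brw_pos_append assms(1))
qed

lemma measurable_in_tree [measurable]: "Measurable.pred (brw_space p E) (\<lambda>\<omega>. in_tree (fst \<omega>) v)"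
  by (induction v) (simp_all, measurable)

lemma measurable_brw_pos [measurable]: "(\<lambda>\<omega>. brw_pos x (snd \<omega>) v) \<in> brw_space p E \<rightarrow>\<^sub>M count_space UNIV"
proof (induction v)
  case Nil then show ?case by simp
next
  case (Cons i v)
  show ?case unfolding brw_pos.simps
    by (rule measurable_compose_countable[where f="\<lambda>y \<omega>. snd \<omega> (i # v, y)", OF _ Cons]) measurable
qed

lemma measurable_reaches [measurable]: "Measurable.pred (brw_space p E) (\<lambda>\<omega>. reaches r n \<omega> x)"
  unfolding reaches_def by measurable

lemma measurable_child_fun:
  assumes "\<And>z. F z \<in> brw_space p E \<rightarrow>\<^sub>M N"
  shows "(\<lambda>\<omega>. F (snd \<omega> ([i], x)) (subtree i \<omega>)) \<in> brw_space p E \<rightarrow>\<^sub>M N"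
  by (rule measurable_compose_countable[where g="\<lambda>\<omega>. snd \<omega> ([i], x)"])
     (rule measurable_compose[OF measurable_subtree assms], measurable)

lemma measurable_occupation [measurable]: "(\<lambda>\<omega>. occupation n \<omega> x y) \<in> borel_measurable (brw_space p E)"
proof (induction n arbitrary: x)
  case 0 then show ?case by simp
next
  case (Suc n)
  have [measurable]: "(\<lambda>\<omega>. occupation n (subtree i \<omega>) (snd \<omega> ([i], x)) y) \<in> borel_measurable (brw_space p E)" for i
    by (rule measurable_child_fun) (rule Suc)
  show ?case unfolding occupation.simps branch_avg_def by measurable
qed

context bounded_graph
begin

lemma nn_integral_nbr_pmf:
  assumes "\<And>z. 0 \<le> f z"
  shows "(\<integral>\<^sup>+z. ennreal (f z) \<partial>nbr_pmf E x) = ennreal (avg E f x)"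
proof -
  have "(\<integral>\<^sup>+z. ennreal (f z) \<partial>nbr_pmf E x) = (\<Sum>z\<in>nbrs E x. ennreal (f z)) / card (nbrs E x)"
    unfolding nbr_pmf_def by (rule nn_integral_pmf_of_set[OF nbrs_nonempty finite_nbrs])
  also have "\<dots> = ennreal (sum f (nbrs E x)) / ennreal (real (deg E x))"
    using assms by (simp add: sum_ennreal deg_def ennreal_of_nat_eq_real_of_nat)
  also have "\<dots> = ennreal (avg E f x)"
    unfolding avg_def using assms deg_pos by (intro divide_ennreal sum_nonneg) auto
  finally show ?thesis .
qed

end

text \<open>The branching property with the constant 1 at the other child.\<close>

lemma nn_integral_branch_single:
  assumes F: "\<And>z. F z \<in> borel_measurable (brw_space p E)" and i: "i = 0 \<or> i = 1"
  shows "(\<integral>\<^sup>+\<omega>. a (fst \<omega> []) * F (snd \<omega> ([i], x)) (subtree i \<omega>) \<partial>brw_space p E)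
    = (\<integral>\<^sup>+n. a n \<partial>p) * (\<integral>\<^sup>+z. \<integral>\<^sup>+\<omega>. F z \<omega> \<partial>brw_space p E \<partial>nbr_pmf E x)"
proof -
  interpret prob_space "brw_space p E" by (rule prob_space_brw_space)
  from i show ?thesis
    using nn_integral_brw_branch[of F p E "\<lambda>_ _. 1" a x] nn_integral_brw_branch[of "\<lambda>_ _. 1" p E F a x] F
    by (auto simp: emeasure_space_1)
qed

lemma borel_measurable_root: "(\<lambda>\<omega>. a (fst \<omega> [])) \<in> borel_measurable (brw_space p E)"
  by (rule measurable_compose[where N="count_space UNIV"]) auto

section \<open>First and second moments of one branching step\<close>

locale offspring =
  fixes p :: "nat pmf"
  assumes p0: "pmf p 0 = 0" and p1: "pmf p 1 < 1"
begin

text \<open>As no node is childless, this is the probability of at least two children.\<close>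

definition q :: real where "q = 1 - pmf p 1"

lemma q: "0 < q" "q \<le> 1"
  using p1 by (auto simp: q_def)

lemma prob_less_2: "emeasure p {..<2} = ennreal (1 - q)"
proof -
  have "{..<2} = {0, 1 :: nat}" by auto
  then show ?thesis using p0
    by (simp add: measure_pmf.emeasure_eq_measure measure_measure_pmf_finite q_def)
qed

lemma prob_ge_2: "emeasure p {2..} = ennreal q"
proof -
  have "measure p {2..} = 1 - measure p {..<2}"
  proof -
    have "{2..} = UNIV - {..<2::nat}" by auto
    then show ?thesis using measure_pmf.prob_compl[of "{..<2}" p] by simp
  qed
  moreover have "measure p {..<2} = 1 - q"
    using prob_less_2 q by (simp add: measure_pmf.emeasure_eq_measure)
  ultimately show ?thesis by (simp add: measure_pmf.emeasure_eq_measure)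
qed

lemma ennreal_add_two_mult:
  assumes "0 \<le> a" "0 \<le> b" "0 \<le> c"
  shows "ennreal (a + (b * c + b * c)) * I = ennreal a * I + (ennreal b * ennreal c * I + ennreal b * ennreal c * I)"
proof -
  have "ennreal (a + (b * c + b * c)) = ennreal a + (ennreal b * ennreal c + ennreal b * ennreal c)"
    using assms by (simp only: ennreal_plus ennreal_mult mult_nonneg_nonneg add_nonneg_nonneg)
  then show ?thesis by (simp only: distrib_right)
qed

text \<open>The weights sum to one and each child makes a random walk step, so in the mean the flow
  performs a single random walk step.\<close>

lemma nn_integral_branch_avg:
  assumes F: "\<And>z. F z \<in> borel_measurable (brw_space p E)" and pos: "\<And>z \<omega>. 0 \<le> F z \<omega>"
  shows "(\<integral>\<^sup>+\<omega>. ennreal (branch_avg \<omega> (\<lambda>i. F (snd \<omega> ([i], x)) (subtree i \<omega>))) \<partial>brw_space p E)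
    = (\<integral>\<^sup>+z. \<integral>\<^sup>+\<omega>. ennreal (F z \<omega>) \<partial>brw_space p E \<partial>nbr_pmf E x)" (is "_ = ?I")
proof -
  define hf :: real where "hf = 1 / 2"
  have hf: "0 \<le> hf" "hf * q + hf * q = q" by (simp_all add: hf_def)
  have half: "(s + t) / 2 = hf * s + hf * t" for s t by (simp add: hf_def)
  let ?M = "brw_space p E" and ?F = "\<lambda>i \<omega>. F (snd \<omega> ([i], x)) (subtree i \<omega>)"
  let ?a = "\<lambda>n. indicator {..<2} n :: ennreal" and ?b = "\<lambda>n. ennreal hf * indicator {2..} n"
  have [measurable]: "?F i \<in> borel_measurable ?M" for i
    by (rule measurable_child_fun) (rule F)
  have [measurable]: "(\<lambda>\<omega>. ?a (fst \<omega> [])) \<in> borel_measurable ?M" "(\<lambda>\<omega>. ?b (fst \<omega> [])) \<in> borel_measurable ?M"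
    by (rule borel_measurable_root)+
  have F': "(\<lambda>\<omega>. ennreal (F z \<omega>)) \<in> borel_measurable ?M" for z using F by measurable
  have "ennreal (branch_avg \<omega> (\<lambda>i. ?F i \<omega>)) = ?a (fst \<omega> []) * ?F 0 \<omega> + (?b (fst \<omega> []) * ?F 0 \<omega> + ?b (fst \<omega> []) * ?F 1 \<omega>)" for \<omega>
    unfolding branch_avg_def half using pos hf by (simp add: ennreal_mult)
  then have "(\<integral>\<^sup>+\<omega>. ennreal (branch_avg \<omega> (\<lambda>i. ?F i \<omega>)) \<partial>?M) =
     (\<integral>\<^sup>+\<omega>. ?a (fst \<omega> []) * ?F 0 \<omega> \<partial>?M) + ((\<integral>\<^sup>+\<omega>. ?b (fst \<omega> []) * ?F 0 \<omega> \<partial>?M) + (\<integral>\<^sup>+\<omega>. ?b (fst \<omega> []) * ?F 1 \<omega> \<partial>?M))"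
    by (simp add: nn_integral_add)
  also have "\<dots> = ennreal (1 - q) * ?I + (ennreal hf * ennreal q * ?I + ennreal hf * ennreal q * ?I)"
    using nn_integral_branch_single[where F="\<lambda>z \<omega>. ennreal (F z \<omega>)" and i=0 and a="?a" and x=x and p=p and E=E] nn_integral_branch_single[where F="\<lambda>z \<omega>. ennreal (F z \<omega>)" and i=0 and a="?b" and x=x and p=p and E=E]
      nn_integral_branch_single[where F="\<lambda>z \<omega>. ennreal (F z \<omega>)" and i=1 and a="?b" and x=x and p=p and E=E]
    using F' by (simp add: nn_integral_cmult prob_less_2 prob_ge_2)
  also have "\<dots> = ennreal ((1 - q) + (hf * q + hf * q)) * ?I"
    by (rule ennreal_add_two_mult[symmetric]) (use q hf in auto)
  finally show ?thesis by (simp add: hf)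
qed

text \<open>The square terms get total weight \<open>(1 - q) + 2 * q / 4\<close>, the cross term
  gets \<open>q / 2\<close> and factorises by independence. The weight \<open>1 - q / 2 < 1\<close>
  makes second moments contract.\<close>

lemma nn_integral_branch_avg_square:
  assumes F: "\<And>z. F z \<in> borel_measurable (brw_space p E)" and pos: "\<And>z \<omega>. 0 \<le> F z \<omega>"
  shows "(\<integral>\<^sup>+\<omega>. ennreal ((branch_avg \<omega> (\<lambda>i. F (snd \<omega> ([i], x)) (subtree i \<omega>)))\<^sup>2) \<partial>brw_space p E)
    = ennreal (1 - q / 2) * (\<integral>\<^sup>+z. \<integral>\<^sup>+\<omega>. ennreal ((F z \<omega>)\<^sup>2) \<partial>brw_space p E \<partial>nbr_pmf E x)
      + ennreal (q / 2) * (\<integral>\<^sup>+z. \<integral>\<^sup>+\<omega>. ennreal (F z \<omega>) \<partial>brw_space p E \<partial>nbr_pmf E x)\<^sup>2"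
    (is "_ = ennreal (1 - q / 2) * ?J + ennreal (q / 2) * ?I\<^sup>2")
proof -
  define hf qt :: real where "hf = 1 / 2" and "qt = 1 / 4"
  have nonneg: "0 \<le> hf" "0 \<le> qt" and qt: "1 - q + (qt * q + qt * q) = 1 - q / 2" and hf: "hf * q = q / 2"
    by (simp_all add: hf_def qt_def)
  have sq: "((s + t) / 2)\<^sup>2 = qt * s\<^sup>2 + (qt * t\<^sup>2 + hf * (s * t))" for s t
    by (simp add: hf_def qt_def power2_eq_square field_simps)
  let ?M = "brw_space p E" and ?F = "\<lambda>i \<omega>. F (snd \<omega> ([i], x)) (subtree i \<omega>)"
  let ?a = "\<lambda>n. indicator {..<2} n :: ennreal" and ?b = "\<lambda>n. ennreal qt * indicator {2..} n"
    and ?c = "\<lambda>n. ennreal hf * indicator {2..} n"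
  have [measurable]: "?F i \<in> borel_measurable ?M" for i
    by (rule measurable_child_fun) (rule F)
  have [measurable]: "(\<lambda>\<omega>. ?a (fst \<omega> [])) \<in> borel_measurable ?M" "(\<lambda>\<omega>. ?b (fst \<omega> [])) \<in> borel_measurable ?M"
    "(\<lambda>\<omega>. ?c (fst \<omega> [])) \<in> borel_measurable ?M"
    by (rule borel_measurable_root)+
  have F': "(\<lambda>\<omega>. ennreal (F z \<omega>)) \<in> borel_measurable ?M"
    and F2: "(\<lambda>\<omega>. ennreal ((F z \<omega>)\<^sup>2)) \<in> borel_measurable ?M" for z using F by measurable
  have "ennreal ((branch_avg \<omega> (\<lambda>i. ?F i \<omega>))\<^sup>2) = ?a (fst \<omega> []) * ennreal ((?F 0 \<omega>)\<^sup>2)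
     + (?b (fst \<omega> []) * ennreal ((?F 0 \<omega>)\<^sup>2) + (?b (fst \<omega> []) * ennreal ((?F 1 \<omega>)\<^sup>2)
     + ?c (fst \<omega> []) * (ennreal (?F 0 \<omega>) * ennreal (?F 1 \<omega>))))" for \<omega>
    using pos nonneg by (simp add: branch_avg_def sq ennreal_mult)
  then have "(\<integral>\<^sup>+\<omega>. ennreal ((branch_avg \<omega> (\<lambda>i. ?F i \<omega>))\<^sup>2) \<partial>?M) =
     (\<integral>\<^sup>+\<omega>. ?a (fst \<omega> []) * ennreal ((?F 0 \<omega>)\<^sup>2) \<partial>?M) + ((\<integral>\<^sup>+\<omega>. ?b (fst \<omega> []) * ennreal ((?F 0 \<omega>)\<^sup>2) \<partial>?M)
      + ((\<integral>\<^sup>+\<omega>. ?b (fst \<omega> []) * ennreal ((?F 1 \<omega>)\<^sup>2) \<partial>?M)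
      + (\<integral>\<^sup>+\<omega>. ?c (fst \<omega> []) * (ennreal (?F 0 \<omega>) * ennreal (?F 1 \<omega>)) \<partial>?M)))"
    by (simp add: nn_integral_add)
  also have "\<dots> = ennreal (1 - q) * ?J + (ennreal qt * ennreal q * ?J + (ennreal qt * ennreal q * ?J + ennreal hf * ennreal q * (?I * ?I)))"
    using nn_integral_branch_single[where F="\<lambda>z \<omega>. ennreal ((F z \<omega>)\<^sup>2)" and i=0 and a="?a" and x=x and p=p and E=E] nn_integral_branch_single[where F="\<lambda>z \<omega>. ennreal ((F z \<omega>)\<^sup>2)" and i=0 and a="?b" and x=x and p=p and E=E]
      nn_integral_branch_single[where F="\<lambda>z \<omega>. ennreal ((F z \<omega>)\<^sup>2)" and i=1 and a="?b" and x=x and p=p and E=E] nn_integral_brw_branch[where ?F0.0="\<lambda>z \<omega>. ennreal (F z \<omega>)" and ?F1.0="\<lambda>z \<omega>. ennreal (F z \<omega>)" and a="?c" and x=x and p=p and E=E]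
    using F' F2 by (simp add: nn_integral_cmult prob_less_2 prob_ge_2)
  also have "\<dots> = ennreal (1 - q + (qt * q + qt * q)) * ?J + ennreal (hf * q) * ?I\<^sup>2"
    by (subst ennreal_add_two_mult) (use q nonneg in \<open>auto simp: ennreal_mult power2_eq_square add.assoc\<close>)
  finally show ?thesis by (simp only: qt hf)
qed

end

section \<open>From transience of the branching walk to finite energy\<close>

locale brw_on_graph = offspring p + bounded_graph E D for p E D
begin

lemma nn_integral_occupation:
  "(\<integral>\<^sup>+\<omega>. ennreal (occupation n \<omega> x y) \<partial>brw_space p E) = ennreal (\<Sum>k<n. heat E k x y)"
proof (induction n arbitrary: x)
  case 0 show ?case by simp
next
  case (Suc n)
  interpret P: prob_space "brw_space p E" by (rule prob_space_brw_space)
  have [measurable]: "(\<lambda>\<omega>. branch_avg \<omega> (\<lambda>i. occupation n (subtree i \<omega>) (snd \<omega> ([i], x)) y)) \<in> borel_measurable (brw_space p E)"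
    using borel_measurable_diff[OF measurable_occupation[of "Suc n" x y] borel_measurable_const[of "of_bool (x = y)"]] by simp
  have "(\<integral>\<^sup>+\<omega>. ennreal (occupation (Suc n) \<omega> x y) \<partial>brw_space p E) =
      (\<integral>\<^sup>+\<omega>. ennreal (of_bool (x = y)) + ennreal (branch_avg \<omega> (\<lambda>i. occupation n (subtree i \<omega>) (snd \<omega> ([i], x)) y)) \<partial>brw_space p E)"
    by (simp only: occupation.simps ennreal_plus of_bool_def branch_avg_nonneg occupation_nonneg zero_le_one order_refl split: if_split) simp
  also have "\<dots> = ennreal (of_bool (x = y)) + (\<integral>\<^sup>+z. ennreal (\<Sum>k<n. heat E k z y) \<partial>nbr_pmf E x)"
    by (subst nn_integral_add) (simp_all add: P.emeasure_space_1 nn_integral_branch_avg[of "\<lambda>z \<omega>. occupation n \<omega> z y"] occupation_nonneg Suc.IH)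
  also have "(\<integral>\<^sup>+z. ennreal (\<Sum>k<n. heat E k z y) \<partial>nbr_pmf E x) = ennreal (\<Sum>k<n. heat E (Suc k) x y)"
    by (subst nn_integral_nbr_pmf) (simp_all add: sum_nonneg heat_nonneg avg_sum heat_Suc)
  also have "ennreal (of_bool (x = y)) + \<dots> = ennreal (\<Sum>k<Suc n. heat E k x y)"
    by (subst sum.lessThan_Suc_shift) (simp add: heat_0 sum_nonneg heat_nonneg)
  finally show ?case .
qed

end

context brw_on_graph
begin

text \<open>\<open>heat_diag_le_of_survival\<close> applied to the probabilities of late visits to
  \<open>r\<close>; transience of the branching walk supplies their convergence to zero.\<close>

lemma heat_diag_le:
  assumes "brw_transient p E r"
  shows "heat E N x x \<le> (1 / (1 + q / 2)) ^ N"
proof -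
  let ?M = "brw_space p E"
  interpret P: prob_space ?M by (rule prob_space_brw_space)
  define h where "h n x = P.prob {\<omega> \<in> space ?M. reaches r n \<omega> x}" for n x
  have ev [measurable]: "{\<omega> \<in> space ?M. reaches r n \<omega> x} \<in> sets ?M" for n x by measurable
  have h1: "h n x \<le> 1" for n x by (simp add: h_def)
  have h0: "0 \<le> h n x" for n x by (simp add: h_def)
  have compl_eq: "space ?M - {\<omega> \<in> space ?M. reaches r n \<omega> x} = {\<omega>. \<not> reaches r n \<omega> x}" for n x
    by (auto simp: space_brw_space)
  have nev: "{\<omega>. \<not> reaches r n \<omega> x} \<in> sets ?M" for n x
    unfolding compl_eq[symmetric] by (rule sets.compl_sets[OF ev])
  have compl: "(\<integral>\<^sup>+\<omega>. indicator {\<omega>. \<not> reaches r n \<omega> x} \<omega> \<partial>?M) = ennreal (1 - h n x)" for n x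
    using P.prob_compl[OF ev, of n x] nev by (simp add: compl_eq h_def P.emeasure_eq_measure)
  have dec: "h (Suc n) x \<le> h n x" for n x
    unfolding h_def by (rule P.finite_measure_mono[OF _ ev]) (auto simp: reaches_def intro: Suc_leD)
  \<comment> \<open>Avoiding \<open>r\<close> from generation \<open>n + 1\<close> on forces the
    first child, and the second if present, to avoid it from generation \<open>n\<close> on.
    Ignoring further children gives the inequality.\<close>
  have step: "avg E (h n) x + q * (avg E (h n) x * (1 - avg E (h n) x)) \<le> h (Suc n) x" for n x
  proof -
    let ?F = "\<lambda>z \<omega>. indicator {\<omega>. \<not> reaches r n \<omega> z} \<omega> :: ennreal"
    have F: "?F z \<in> borel_measurable ?M" for z
      by (rule borel_measurable_indicator) (rule nev)
    define t where "t = avg E (h n) x"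
    have t: "0 \<le> t" "t \<le> 1" unfolding t_def using h0 h1 by (auto intro: avg_nonneg avg_le_1)
    have mean: "(\<integral>\<^sup>+z. \<integral>\<^sup>+\<omega>. ?F z \<omega> \<partial>?M \<partial>nbr_pmf E x) = ennreal (1 - t)"
    proof -
      have "avg E (\<lambda>z. 1 - h n z) x = 1 - t"
      proof -
        have "avg E (\<lambda>z. 1 - h n z) x = avg E (\<lambda>_. 1) x - avg E (h n) x"
          by (simp add: avg_def sum_subtractf diff_divide_distrib)
        then show ?thesis by (simp only: avg_const t_def)
      qed
      then show ?thesis by (simp only: compl) (simp add: nn_integral_nbr_pmf h1)
    qed
    let ?X = "\<lambda>i \<omega>. ?F (snd \<omega> ([i], x)) (subtree i \<omega>)"
    have [measurable]: "?X i \<in> borel_measurable ?M" for i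
      by (rule measurable_child_fun) (rule F)
    have [measurable]: "(\<lambda>\<omega>. indicator A (fst \<omega> []) :: ennreal) \<in> borel_measurable ?M" for A :: "nat set"
      by (rule borel_measurable_root)
    have "ennreal (1 - h (Suc n) x) = (\<integral>\<^sup>+\<omega>. indicator {\<omega>. \<not> reaches r (Suc n) \<omega> x} \<omega> \<partial>?M)"
      by (rule compl[symmetric])
    \<comment> \<open>The first summand covers a childless root, an event of probability zero on
      which child 0 is not in the tree.\<close>
    also have "\<dots> \<le> (\<integral>\<^sup>+\<omega>. indicator {0} (fst \<omega> []) + (indicator {..<2} (fst \<omega> []) * ?X 0 \<omega>
        + indicator {2..} (fst \<omega> []) * (?X 0 \<omega> * ?X 1 \<omega>)) \<partial>?M)"
    proof (rule nn_integral_mono)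
      fix \<omega> :: brw
      consider "fst \<omega> [] = 0" | "fst \<omega> [] = 1" | "fst \<omega> [] \<ge> 2" by linarith
      then show "indicator {\<omega>. \<not> reaches r (Suc n) \<omega> x} \<omega> \<le> (indicator {0} (fst \<omega> []) + (indicator {..<2} (fst \<omega> []) * ?X 0 \<omega>
        + indicator {2..} (fst \<omega> []) * (?X 0 \<omega> * ?X 1 \<omega>)) :: ennreal)"
        using reaches_child[of 0 \<omega> r n x] reaches_child[of 1 \<omega> r n x]
        by cases (auto simp: indicator_def)
    qed
    also have "\<dots> = (\<integral>\<^sup>+\<omega>. indicator {0} (fst \<omega> []) * 1 \<partial>?M) + ((\<integral>\<^sup>+\<omega>. indicator {..<2} (fst \<omega> []) * ?X 0 \<omega> \<partial>?M)
        + (\<integral>\<^sup>+\<omega>. indicator {2..} (fst \<omega> []) * (?X 0 \<omega> * ?X 1 \<omega>) \<partial>?M))"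
      by (simp add: nn_integral_add)
    also have "\<dots> = ennreal (1 - q) * ennreal (1 - t) + ennreal q * (ennreal (1 - t) * ennreal (1 - t))"
      using nn_integral_branch_single[where F="\<lambda>_ _. 1" and i=0 and a="indicator {0}" and x=x and p=p and E=E]
        nn_integral_branch_single[where F="?F" and i=0 and a="indicator {..<2}" and x=x and p=p and E=E]
        nn_integral_brw_branch[where ?F0.0="?F" and ?F1.0="?F" and a="indicator {2..}" and x=x and p=p and E=E] F
      by (simp only: mean prob_less_2 prob_ge_2 nn_integral_indicator sets_measure_pmf UNIV_I)
         (simp add: emeasure_pmf_single p0)
    also have "\<dots> = ennreal ((1 - q) * (1 - t) + q * ((1 - t) * (1 - t)))"
      using q t by (simp add: ennreal_mult)
    finally have "1 - h (Suc n) x \<le> (1 - q) * (1 - t) + q * ((1 - t) * (1 - t))"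
      by (subst (asm) ennreal_le_iff) (use q t in auto)
    then have "t + q * (t * (1 - t)) \<le> h (Suc n) x" by (simp add: algebra_simps)
    then show ?thesis by (simp only: t_def)
  qed
  have root: "h 0 r = 1"
  proof -
    have "reaches r 0 \<omega> r" for \<omega> unfolding reaches_def by (intro exI[of _ "[]"]) simp
    then show ?thesis by (simp add: h_def P.prob_space)
  qed
  have lim: "(\<lambda>n. h n r) \<longlonglongrightarrow> 0"
  proof -
    let ?A = "\<lambda>n. {\<omega> \<in> space ?M. reaches r n \<omega> r}"
    \<comment> \<open>The intersection of these decreasing events requires visits to
      \<open>r\<close> at nodes of unbounded length, hence infinitely many of them.\<close>
    have "(\<lambda>n. P.prob (?A n)) \<longlonglongrightarrow> P.prob (\<Inter>n. ?A n)"
      by (rule P.finite_Lim_measure_decseq) (auto simp: decseq_def reaches_def intro: le_trans)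
    moreover have "P.prob (\<Inter>n. ?A n) = 0"
    proof (subst P.prob_eq_0)
      show "(\<Inter>n. ?A n) \<in> P.events"
        by (rule sets.countable_INT'') (use sets.top[of ?M] ev in \<open>auto simp only: space_brw_space\<close>)
      have "AE \<omega> in ?M. finite {v. in_tree (fst \<omega>) v \<and> brw_pos r (snd \<omega>) v = r}"
        using assms by (simp add: brw_transient_def)
      then show "AE \<omega> in ?M. \<omega> \<notin> (\<Inter>n. ?A n)"
      proof eventually_elim
        case (elim \<omega>)
        show ?case
        proof
          assume "\<omega> \<in> (\<Inter>n. ?A n)"
          then have all: "reaches r n \<omega> r" for n by auto
          have "finite (length ` {v. in_tree (fst \<omega>) v \<and> brw_pos r (snd \<omega>) v = r})" using elim by simp
          then obtain k where k: "length ` {v. in_tree (fst \<omega>) v \<and> brw_pos r (snd \<omega>) v = r} \<subseteq> {..<k}"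
            using finite_nat_bounded by blast
          from all[of k] obtain v where "k \<le> length v" "in_tree (fst \<omega>) v" "brw_pos r (snd \<omega>) v = r"
            by (auto simp: reaches_def)
          moreover from this k have "length v < k" by blast
          ultimately show False by simp
        qed
      qed
    qed
    ultimately show ?thesis by (simp add: h_def)
  qed
  show ?thesis
    by (rule heat_diag_le_of_survival[OF q h0 h1 dec step root lim])
qed

text \<open>The first-step recursion has contraction factor \<open>1 - q / 2\<close> and a source
  bounded by \<open>green_bounds\<close>. \<open>K\<close> is the resulting fixed point, source
  bound divided by \<open>q / 2\<close>, so it is preserved at every step and for every
  start.\<close>

lemma occupation_square_bound:
  fixes l :: real
  assumes l: "0 \<le> l" "l < 1" and le: "\<And>x n. heat E n x x \<le> l ^ n"
  defines "K \<equiv> (1 + 2 / (1 - l) + D / (1 - l)\<^sup>2) / (q / 2)"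
  assumes Y: "finite Y"
  shows "(\<Sum>y\<in>Y. \<integral>\<^sup>+\<omega>. ennreal ((occupation n \<omega> x y)\<^sup>2) \<partial>brw_space p E) \<le> ennreal K"
proof (induction n arbitrary: x)
  case 0 show ?case by simp
next
  case (Suc n)
  let ?M = "brw_space p E"
  interpret P: prob_space ?M by (rule prob_space_brw_space)
  let ?A = "\<lambda>y \<omega>. branch_avg \<omega> (\<lambda>i. occupation n (subtree i \<omega>) (snd \<omega> ([i], x)) y)"
  let ?g = "\<lambda>y. \<Sum>k<n. heat E (Suc k) x y"
  let ?S = "\<lambda>y. \<integral>\<^sup>+z. \<integral>\<^sup>+\<omega>. ennreal ((occupation n \<omega> z y)\<^sup>2) \<partial>?M \<partial>nbr_pmf E x"
  have K0: "0 \<le> K" unfolding K_def using l q by auto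
  have A0: "0 \<le> ?A y \<omega>" for y \<omega> by (simp add: branch_avg_nonneg occupation_nonneg)
  have [measurable]: "?A y \<in> borel_measurable ?M" for y
    using borel_measurable_diff[OF measurable_occupation[of "Suc n" x y] borel_measurable_const[of "of_bool (x = y)"]] by simp
  have g: "(\<integral>\<^sup>+z. \<integral>\<^sup>+\<omega>. ennreal (occupation n \<omega> z y) \<partial>?M \<partial>nbr_pmf E x) = ennreal (?g y)" for y
    by (simp add: nn_integral_occupation nn_integral_nbr_pmf sum_nonneg heat_nonneg avg_sum heat_Suc)
  have g0: "0 \<le> ?g y" for y by (intro sum_nonneg heat_nonneg)
  have point: "(\<integral>\<^sup>+\<omega>. ennreal ((occupation (Suc n) \<omega> x y)\<^sup>2) \<partial>?M) =
      ennreal (of_bool (x = y) * (1 + 2 * ?g y) + q / 2 * (?g y)\<^sup>2) + ennreal (1 - q / 2) * ?S y" for y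
  proof -
    define b where "b = (of_bool (x = y) :: real)"
    \<comment> \<open>An indicator equals its own square, which simplifies the expansion
      below.\<close>
    have b: "0 \<le> b" "b\<^sup>2 = b" by (auto simp: b_def)
    have "(b + s)\<^sup>2 = b + (2 * b * s + s\<^sup>2)" for s using b(2) by (simp add: power2_sum)
    then have "(\<integral>\<^sup>+\<omega>. ennreal ((occupation (Suc n) \<omega> x y)\<^sup>2) \<partial>?M) =
        (\<integral>\<^sup>+\<omega>. ennreal b + (ennreal (2 * b) * ennreal (?A y \<omega>) + ennreal ((?A y \<omega>)\<^sup>2)) \<partial>?M)"
      using b A0 by (simp add: b_def[symmetric] ennreal_mult)
    also have "\<dots> = ennreal b + (ennreal (2 * b) * (\<integral>\<^sup>+\<omega>. ennreal (?A y \<omega>) \<partial>?M) + (\<integral>\<^sup>+\<omega>. ennreal ((?A y \<omega>)\<^sup>2) \<partial>?M))"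
      by (simp add: nn_integral_add nn_integral_cmult P.emeasure_space_1)
    also have "(\<integral>\<^sup>+\<omega>. ennreal (?A y \<omega>) \<partial>?M) = ennreal (?g y)"
      using nn_integral_branch_avg[where F="\<lambda>z \<omega>. occupation n \<omega> z y"] by (simp add: occupation_nonneg g)
    also have "(\<integral>\<^sup>+\<omega>. ennreal ((?A y \<omega>)\<^sup>2) \<partial>?M) = ennreal (1 - q / 2) * ?S y + ennreal (q / 2) * (ennreal (?g y))\<^sup>2"
      using nn_integral_branch_avg_square[where F="\<lambda>z \<omega>. occupation n \<omega> z y"] by (simp add: occupation_nonneg g)
    also have "ennreal b + (ennreal (2 * b) * ennreal (?g y) + (ennreal (1 - q / 2) * ?S y + ennreal (q / 2) * (ennreal (?g y))\<^sup>2))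
       = (ennreal b + (ennreal (2 * b) * ennreal (?g y) + ennreal (q / 2) * (ennreal (?g y))\<^sup>2)) + ennreal (1 - q / 2) * ?S y"
      by (simp only: add_ac)
    also have "ennreal b + (ennreal (2 * b) * ennreal (?g y) + ennreal (q / 2) * (ennreal (?g y))\<^sup>2)
       = ennreal (b + (2 * b * ?g y + q / 2 * (?g y)\<^sup>2))"
      using b g0[of y] q by (simp only: ennreal_power ennreal_mult[symmetric] ennreal_plus[symmetric] add_nonneg_nonneg mult_nonneg_nonneg zero_le_power2)
    finally show ?thesis by (simp add: b_def algebra_simps)
  qed
  have "(\<Sum>y\<in>Y. of_bool (x = y) * (1 + 2 * ?g y) + q / 2 * (?g y)\<^sup>2) \<le> K * (q / 2)"
  proof -
    have "(\<Sum>y\<in>Y. of_bool (x = y) * (1 + 2 * ?g y)) = (\<Sum>y\<in>Y. if y = x then 1 + 2 * ?g x else 0)"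
      by (intro sum.cong) auto
    also have "\<dots> \<le> 1 + 2 * ?g x" using Y g0[of x] by simp
    also have "\<dots> \<le> 1 + 2 * (1 / (1 - l))"
      using green_bounds(1)[OF l le, where m=n and x=x] by simp
    finally have 1: "(\<Sum>y\<in>Y. of_bool (x = y) * (1 + 2 * ?g y)) \<le> 1 + 2 / (1 - l)" by simp
    have "(\<Sum>y\<in>Y. q / 2 * (?g y)\<^sup>2) = q / 2 * (\<Sum>y\<in>Y. (?g y)\<^sup>2)" by (simp add: sum_distrib_left)
    also have "\<dots> \<le> 1 * (D / (1 - l)\<^sup>2)"
      using green_bounds(2)[OF l le Y, where m=n and x=x] q by (intro mult_mono) (auto intro: sum_nonneg)
    finally have 2: "(\<Sum>y\<in>Y. q / 2 * (?g y)\<^sup>2) \<le> D / (1 - l)\<^sup>2" by simp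
    have "K * (q / 2) = 1 + 2 / (1 - l) + D / (1 - l)\<^sup>2" using q by (simp add: K_def)
    with add_mono[OF 1 2] show ?thesis by (simp only: sum.distrib)
  qed
  then have "(\<Sum>y\<in>Y. ennreal (of_bool (x = y) * (1 + 2 * ?g y) + q / 2 * (?g y)\<^sup>2)) \<le> ennreal (K * (q / 2))"
    using q g0 by (subst sum_ennreal) (auto intro!: add_nonneg_nonneg ennreal_leI)
  moreover have "(\<Sum>y\<in>Y. ?S y) \<le> ennreal K"
  proof -
    \<comment> \<open>The induction hypothesis is uniform in the starting vertex, so it may be
      averaged over the first step.\<close>
    have "(\<Sum>y\<in>Y. ?S y) = (\<integral>\<^sup>+z. (\<Sum>y\<in>Y. \<integral>\<^sup>+\<omega>. ennreal ((occupation n \<omega> z y)\<^sup>2) \<partial>?M) \<partial>nbr_pmf E x)"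
      by (simp add: nn_integral_sum)
    also have "\<dots> \<le> (\<integral>\<^sup>+z. ennreal K \<partial>nbr_pmf E x)"
      by (intro nn_integral_mono Suc.IH)
    finally show ?thesis by simp
  qed
  ultimately have "(\<Sum>y\<in>Y. \<integral>\<^sup>+\<omega>. ennreal ((occupation (Suc n) \<omega> x y)\<^sup>2) \<partial>?M) \<le> ennreal (K * (q / 2)) + ennreal (1 - q / 2) * ennreal K"
    unfolding point sum.distrib sum_distrib_left[symmetric] by (intro add_mono mult_left_mono) auto
  also have "\<dots> = ennreal (K * (q / 2) + (1 - q / 2) * K)"
    using K0 q by (simp add: ennreal_mult[symmetric] ennreal_plus[symmetric] del: ennreal_plus)
  also have "K * (q / 2) + (1 - q / 2) * K = K" by (simp add: algebra_simps)
  finally show ?case .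
qed

text \<open>Time horizon and vertex range grow together, so the sums increase in \<open>n\<close>;
  monotone convergence turns the uniform mean bound into almost sure boundedness.\<close>

lemma occupation_bounded_AE:
  assumes "brw_transient p E r"
  shows "AE \<omega> in brw_space p E. \<exists>B. \<forall>n. (\<Sum>y<n. (occupation n \<omega> r y)\<^sup>2) \<le> B"
proof -
  let ?M = "brw_space p E"
  define l where "l = 1 / (1 + q / 2)"
  have l: "0 \<le> l" "l < 1" using q by (auto simp: l_def)
  have le: "heat E n x x \<le> l ^ n" for n x unfolding l_def by (rule heat_diag_le[OF assms])
  obtain K :: real where K: "\<And>n. (\<Sum>y<n. \<integral>\<^sup>+\<omega>. ennreal ((occupation n \<omega> r y)\<^sup>2) \<partial>?M) \<le> ennreal K"
    using occupation_square_bound[OF l le] by blast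
  define f where "f n \<omega> = (\<Sum>y<n. (occupation n \<omega> r y)\<^sup>2)" for n \<omega>
  have [measurable]: "f n \<in> borel_measurable ?M" for n unfolding f_def by measurable
  have f0: "0 \<le> f n \<omega>" for n \<omega> unfolding f_def by (intro sum_nonneg) auto
  have inc: "incseq (\<lambda>n. f n \<omega>)" for \<omega>
  proof (rule incseq_SucI)
    fix n
    have "f n \<omega> \<le> (\<Sum>y<n. (occupation (Suc n) \<omega> r y)\<^sup>2)"
      unfolding f_def by (intro sum_mono power_mono) (auto simp only: occupation_Suc level_mass_nonneg occupation_nonneg le_add_same_cancel1)
    also have "\<dots> \<le> f (Suc n) \<omega>" unfolding f_def by (rule sum_mono2) auto
    finally show "f n \<omega> \<le> f (Suc n) \<omega>" .
  qed
  have "(\<integral>\<^sup>+\<omega>. (SUP n. ennreal (f n \<omega>)) \<partial>?M) = (SUP n. \<integral>\<^sup>+\<omega>. ennreal (f n \<omega>) \<partial>?M)"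
    by (rule nn_integral_monotone_convergence_SUP)
       (use inc in \<open>auto simp: incseq_def le_fun_def intro: ennreal_leI\<close>)
  also have "\<dots> \<le> ennreal K"
  proof (rule SUP_least)
    fix n
    have "(\<integral>\<^sup>+\<omega>. ennreal (f n \<omega>) \<partial>?M) = (\<Sum>y<n. \<integral>\<^sup>+\<omega>. ennreal ((occupation n \<omega> r y)\<^sup>2) \<partial>?M)"
      unfolding f_def by (simp add: sum_ennreal[symmetric] nn_integral_sum del: sum_ennreal)
    then show "(\<integral>\<^sup>+\<omega>. ennreal (f n \<omega>) \<partial>?M) \<le> ennreal K" using K by simp
  qed
  finally have "(\<integral>\<^sup>+\<omega>. (SUP n. ennreal (f n \<omega>)) \<partial>?M) \<noteq> \<infinity>"
    using le_less_trans[OF _ ennreal_less_top] by (auto simp: less_top)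
  then have "AE \<omega> in ?M. (SUP n. ennreal (f n \<omega>)) \<noteq> \<infinity>"
    by (intro nn_integral_PInf_AE) auto
  then show ?thesis
  proof eventually_elim
    case (elim \<omega>)
    then obtain B where B: "0 \<le> B" "(SUP n. ennreal (f n \<omega>)) = ennreal B"
      by (cases "SUP n. ennreal (f n \<omega>)") auto
    have "f n \<omega> \<le> B" for n
    proof -
      have "ennreal (f n \<omega>) \<le> ennreal B" unfolding B(2)[symmetric] by (rule SUP_upper) simp
      then show ?thesis using B(1) by simp
    qed
    then show ?case unfolding f_def by blast
  qed
qed

lemma trace_transient_AE:
  assumes "brw_transient p E r"
  shows "AE \<omega> in brw_space p E. srw_transient (trace (fst \<omega>) (snd \<omega>) r) r"
proof -
  let ?M = "brw_space p E"
  have N: "AE \<omega> in ?M. \<forall>v. 0 < fst \<omega> v"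
  proof (subst AE_all_countable, intro allI AE_brw_spaceI)
    fix v :: "nat list"
    have "AE n in brw_law p E (Inl v). 0 < n"
      unfolding brw_law_def sum.case AE_measure_pmf_iff
    proof
      fix n assume "n \<in> set_pmf p"
      then show "0 < n" using p0 by (cases n) (auto simp: set_pmf_iff)
    qed
    then show "AE \<omega> in PiM UNIV (brw_law p E). 0 < fst (\<lambda>v. \<omega> (Inl v), \<lambda>q. \<omega> (Inr q)) v"
      using AE_PiM_component[of UNIV "brw_law p E" "Inl v"] by (simp add: prob_space_brw_law)
  qed measurable
  have J: "AE \<omega> in ?M. \<forall>c. snd \<omega> c \<in> nbrs E (snd c)"
  proof (subst AE_all_countable, intro allI AE_brw_spaceI)
    fix c :: "nat list \<times> nat"
    have "AE z in brw_law p E (Inr c). z \<in> nbrs E (snd c)"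
      unfolding brw_law_def sum.case AE_measure_pmf_iff
      by (simp add: nbr_pmf_def set_pmf_of_set[OF nbrs_nonempty finite_nbrs])
    then show "AE \<omega> in PiM UNIV (brw_law p E). snd (\<lambda>v. \<omega> (Inl v), \<lambda>q. \<omega> (Inr q)) c \<in> nbrs E (snd c)"
      using AE_PiM_component[of UNIV "brw_law p E" "Inr c"] by (simp add: prob_space_brw_law)
  qed measurable
  show ?thesis
    using occupation_bounded_AE[OF assms] N J
  proof eventually_elim
    case (elim \<omega>)
    then obtain B where B: "\<And>n. (\<Sum>y<n. (occupation n \<omega> r y)\<^sup>2) \<le> B" by blast
    show ?case
    proof (rule trace_transient[OF _ _ B])
      show "0 < fst \<omega> v" for v using elim by blast
      \<comment> \<open>Local finiteness is inherited because the trace is a subgraph of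
        \<open>E\<close>.\<close>
      show "finite (nbrs (trace (fst \<omega>) (snd \<omega>) r) a)" for a
      proof (rule finite_subset)
        show "nbrs (trace (fst \<omega>) (snd \<omega>) r) a \<subseteq> nbrs E a"
        proof
          fix b assume "b \<in> nbrs (trace (fst \<omega>) (snd \<omega>) r) a"
          then have "trace (fst \<omega>) (snd \<omega>) r a b" by (simp add: nbrs_def)
          then have "E a b"
          proof (rule trace_imp_adj)
            show "snd \<omega> (v, x) \<in> nbrs E x" for v x using elim(3)[rule_format, of "(v, x)"] by simp
            show "E y x" if "E x y" for x y using that adj_sym by blast
          qed
          then show "b \<in> nbrs E a" by (simp add: nbrs_def)
        qed
      qed simp
    qed
  qed
qed

end

theorem theorem3p1:
  fixes \<mu> :: "(graph \<times> nat) measure" and p :: "nat pmf" and D :: nat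
  assumes "unimodular \<mu>"
    and "AE Go in \<mu>. good_graph (fst Go) D"
    and "pmf p 0 = 0" and "pmf p 1 < 1"
    and "(\<Sum>k. ennreal (real k * pmf p k)) < \<infinity>"
    and "AE Go in \<mu>. brw_transient p (fst Go) (snd Go)"
  shows "AE Go in \<mu>. AE \<omega> in brw_space p (fst Go).
           srw_transient (trace (fst \<omega>) (snd \<omega>) (snd Go)) (snd Go)"
  using assms(2,6)
proof eventually_elim
  case (elim Go)
  \<comment> \<open>From here on the graph is fixed and only the walk is random.\<close>
  interpret brw_on_graph p "fst Go" D
    by unfold_locales (use assms elim in auto)
  show ?case by (rule trace_transient_AE) (rule elim)
qed

end
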